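(* For $n,m\in\mathbb{N}$ let $$b_{n,m}:=\sum_{\lambda\in\Omega(n,m)}(-1)^{m+m_2}\frac{m}{m_1+m_2}\binom{m_1+m_2}{m_2-m_5,\;m_5-m_8,\;\ldots,\;m_1-m_4,\;m_4-m_7,\;\ldots}.$$ Then $b_{n,m}\in\mathbb{Z}$, $b_{n,m}=0$ if $m<\left\lfloor\frac12\left(\sqrt{24n+1}-1\right)\right\rfloor$, and for every $k\in\mathbb{N}$ $$h_k(\tau)=-\frac{\delta_{k,1}}2+\sum_{n\ge1}\sum_{m=1}^{2n}b_{n,m}\,m^{k-1}q^n,\qquad \eta(\tau)=q^{\frac1{24}}\exp\left(-\sum_{n\ge1}\sum_{m=1}^{2n}\frac{b_{n,m}}{m}q^n\right).$$
   Context: $\mathbb{N}=\{1,2,\dots\}$, $\tau$ lies in the complex upper half-plane, $q:=e^{2\pi i\tau}$, $\zeta:=e^{2\pi i z}$, with $q^{r}:=e^{2\pi i r\tau}$ for $r\in\mathbb{Q}$. $\delta_{j,\ell}$ is the Kronecker delta. $\eta(\tau):=q^{\frac1{24}}\prod_{n\ge1}(1-q^n)$. A partition $\lambda$ of $n$ is written $\lambda=(1^{m_1},2^{m_2},\dots,n^{m_n})\vdash n$, where $m_j\ge0$ is the multiplicity of $j$ (and $m_j:=0$ for $j>n$); its length is $\ell(\lambda):=\sum_{j=1}^n m_j$. Put $$\Omega(n,m):=\{\lambda\vdash n:\ m_{3j-2}\ge m_{3j+1},\ m_{3j-1}\ge m_{3j+2},\ m_{3j}=0\text{ for all }j\in\mathbb{N},\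 3\ell(\lambda)=m+m_1\}.$$ $\binom{N}{a_1,a_2,\ldots}=\frac{N!}{a_1!a_2!\cdots}$ (with $\sum_j a_j=N$) is the multinomial coefficient. False theta function: $h(\zeta;q):=(1-\zeta)\sum_{n\ge0}(-1)^n\zeta^{3n}q^{\frac{n(3n+1)}2}\left(1-\zeta^2q^{2n+1}\right)$. The false Eisenstein series $h_k$, $k\in\mathbb{N}$, are defined by the expansion around $z=0$ $$h(\zeta;q)=-2i\sin(\pi z)\,q^{-\frac1{24}}\eta(\tau)\exp\left(-\sum_{k\ge1}h_k(\tau)\frac{(2\pi i z)^k}{k!}\right).$$ *)

theory Defs
  imports "HOL-Analysis.Analysis"
begin

text \<open>
  A partition is represented by its multiplicity function: \<open>p j\<close> is the number of parts equal
  to \<open>j\<close>, i.e. \<open>m\<^sub>j\<close>.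
\<close>

definition is_partition :: "(nat \<Rightarrow> nat) \<Rightarrow> nat \<Rightarrow> bool" where
  "is_partition p n \<longleftrightarrow> (\<forall>j. p j \<noteq> 0 \<longrightarrow> 1 \<le> j \<and> j \<le> n) \<and> (\<Sum>j=1..n. j * p j) = n"

definition partition_length :: "nat \<Rightarrow> (nat \<Rightarrow> nat) \<Rightarrow> nat" where
  "partition_length n p = (\<Sum>j=1..n. p j)"

definition Omega :: "nat \<Rightarrow> nat \<Rightarrow> (nat \<Rightarrow> nat) set" where
  "Omega n m = {p. is_partition p n \<and>
     (\<forall>j\<ge>1. p (3*j-2) \<ge> p (3*j+1) \<and> p (3*j-1) \<ge> p (3*j+2) \<and> p (3*j) = 0) \<and>
     3 * partition_length n p = m + p 1}"

lemma finite_Omega: "finite (Omega n m)"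
proof (rule finite_subset)
  show "Omega n m \<subseteq> {p. \<forall>j. (j \<in> {1..n} \<longrightarrow> p j \<in> {0..n}) \<and> (j \<notin> {1..n} \<longrightarrow> p j = 0)}"
  proof clarify
    fix p j assume "p \<in> Omega n m"
    then have supp: "\<And>j. p j \<noteq> 0 \<Longrightarrow> 1 \<le> j \<and> j \<le> n" and sum: "(\<Sum>j=1..n. j * p j) = n"
      by (auto simp: Omega_def is_partition_def)
    have "p j \<le> n" if "j \<in> {1..n}"
    proof -
      have "p j \<le> j * p j" using that by simp
      also have "\<dots> \<le> (\<Sum>j=1..n. j * p j)"
        using that by (intro member_le_sum) auto
      finally show ?thesis using sum by simp
    qed
    then show "(j \<in> {1..n} \<longrightarrow> p j \<in> {0..n}) \<and> (j \<notin> {1..n} \<longrightarrow> p j = 0)"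
      using supp[of j] by auto
  qed
  show "finite {p. \<forall>j. (j \<in> {1..n} \<longrightarrow> p j \<in> {0..n}) \<and> (j \<notin> {1..n} \<longrightarrow> p j = (0::nat))}"
    by (rule finite_set_of_finite_funs) auto
qed

text \<open>
  Multinomial coefficient with lower entries \<open>a i\<close>, \<open>i \<in> I\<close>; meaningful when these sum to \<open>N\<close>.
\<close>

definition multinomial :: "nat \<Rightarrow> nat set \<Rightarrow> (nat \<Rightarrow> nat) \<Rightarrow> real" where
  "multinomial N I a = fact N / (\<Prod>i\<in>I. fact (a i))"

text \<open>
  For a partition in \<open>Omega n m\<close> the lower entries are the differences \<open>p j - p (j + 3)\<close> with
  \<open>j\<close> not divisible by 3; they vanish for \<open>j > n\<close>, and the truncated subtraction is exact
  by the definition of \<open>Omega\<close>.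
\<close>

definition b_coeff :: "nat \<Rightarrow> nat \<Rightarrow> real" where
  "b_coeff n m = (\<Sum>p\<in>Omega n m. (-1) ^ (m + p 2) * (real m / real (p 1 + p 2)) *
     multinomial (p 1 + p 2) {j\<in>{1..n}. \<not> 3 dvd j} (\<lambda>j. p j - p (j + 3)))"

definition qpow :: "complex \<Rightarrow> rat \<Rightarrow> complex" where
  "qpow \<tau> r = exp (2 * of_real pi * \<i> * of_rat r * \<tau>)"

definition eta :: "complex \<Rightarrow> complex" where
  "eta \<tau> = qpow \<tau> (1/24) * (\<Prod>n. 1 - qpow \<tau> 1 ^ Suc n)"

definition false_theta :: "complex \<Rightarrow> complex \<Rightarrow> complex" where
  "false_theta \<zeta> q = (1 - \<zeta>) *
     (\<Sum>n. (-1) ^ n * \<zeta> ^ (3*n) * q ^ (n * (3*n+1) div 2) * (1 - \<zeta>^2 * q ^ (2*n+1)))"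

text \<open>
  \<open>c k\<close> for \<open>k \<ge> 1\<close> are the coefficients in the exponent of the expansion of the false theta
  function around \<open>z = 0\<close>; \<open>c 0\<close> is irrelevant.
\<close>

definition false_theta_expansion :: "complex \<Rightarrow> (nat \<Rightarrow> complex) \<Rightarrow> bool" where
  "false_theta_expansion \<tau> c \<longleftrightarrow>
     (\<forall>\<^sub>F z in nhds 0.
        summable (\<lambda>k. c (Suc k) * (2 * of_real pi * \<i> * z) ^ Suc k / fact (Suc k)) \<and>
        false_theta (exp (2 * of_real pi * \<i> * z)) (qpow \<tau> 1) =
          - 2 * \<i> * sin (of_real pi * z) * qpow \<tau> (-1/24) * eta \<tau> *
          exp (- (\<Sum>k. c (Suc k) * (2 * of_real pi * \<i> * z) ^ Suc k / fact (Suc k))))"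

text \<open>The false Eisenstein series \<open>h\<^sub>k(\<tau>)\<close>, for \<open>k \<ge> 1\<close> and \<open>Im \<tau> > 0\<close>.\<close>

definition false_eisenstein :: "nat \<Rightarrow> complex \<Rightarrow> complex" where
  "false_eisenstein k \<tau> = (THE w. \<exists>c. false_theta_expansion \<tau> c \<and> c k = w)"

end

theory Submission
  imports Defs "HOL-Complex_Analysis.Complex_Analysis"
begin

text \<open>
  Apart from the factor \<open>1 - \<zeta>\<close>, the false theta function is
  \<open>\<Phi> = \<Sum>\<^sub>e \<sigma>\<^sub>e \<zeta>\<^sup>e q\<^bsup>e(e+1)/6\<^esup>\<close> with \<open>\<sigma>\<^sub>e = 0\<close> for \<open>e \<equiv> 1 (mod 3)\<close> and
  \<open>\<sigma>\<^sub>e = \<plusminus>1\<close> otherwise. A partition counted by \<open>\<Omega>(n, m)\<close> is a multiset of columns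
  \<open>{i, i - 3, i - 6, \<dots>}\<close>, \<open>3 \<nmid> i\<close>, and the column with largest part \<open>i = e - 1\<close> contributes
  \<open>e\<close> to \<open>m\<close> and \<open>e(e+1)/6\<close> to \<open>n\<close>. So the signed multinomial coefficients have generating function
  \<open>1/\<Phi>\<close>, and the recursion for multinomial coefficients gives
  \<open>\<Sum> b\<^bsub>n,m\<^esub> \<zeta>\<^sup>m q\<^sup>n = - (\<zeta> \<partial>\<^sub>\<zeta> \<Phi>) / \<Phi>\<close> and \<open>\<Sum> n (b\<^bsub>n,m\<^esub> / m) \<zeta>\<^sup>m q\<^sup>n = - (q \<partial>\<^sub>q \<Phi>) / \<Phi>\<close>.
  Differentiating at \<open>\<zeta> = 1\<close> yields a triangular system for the moments \<open>\<Sum>\<^sub>m b\<^bsub>n,m\<^esub> m\<^sup>k\<close>, which the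
  Taylor coefficients of \<open>- log \<Phi>(e\<^sup>w; q)\<close> satisfy too. Its leading coefficient is
  \<open>\<Phi>(1; q) = \<Prod>\<^sub>n (1 - q\<^sup>n)\<close> by the pentagonal number theorem; this has no zero in the unit disc, so the
  system is uniquely solvable and all solutions are power series converging in the whole disc.
\<close>

section \<open>Removing columns from partitions\<close>

text \<open>For \<open>e\<close> not congruent to 1 mod 3 the division is exact and the values are
  the generalized pentagonal numbers: n(3n+1)/2 at \<open>e = 3n\<close> and (n+1)(3n+2)/2 at
  \<open>e = 3n+2\<close>. In the class 1 mod 3 the truncated value is masked by a zero
  \<open>theta_sign\<close>.\<close>

definition pent :: "nat \<Rightarrow> nat" where
  "pent e = e * (e + 1) div 6"

text \<open>\<open>e mod 3 div 2\<close> is 1 only in the residue class 2, so the indices 3n and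
  3n+2 get the opposite signs (-1)^n and -(-1)^n, as do the two terms of the n-th bracket in
  \<open>false_theta\<close>.\<close>

definition theta_sign :: "nat \<Rightarrow> real" where
  "theta_sign e = (if e mod 3 = 1 then 0 else (-1) ^ (e div 3 + e mod 3 div 2))"

definition residue_column :: "nat \<Rightarrow> nat \<Rightarrow> nat" where
  "residue_column i j = (if 1 \<le> j \<and> j \<le> i \<and> j mod 3 = i mod 3 then 1 else 0)"

text \<open>The number of columns with largest part \<open>j\<close>, for \<open>j\<close> prime to
  3, when a partition in \<open>Omega\<close> is cut into residue columns; these are the lower
  entries of the multinomial coefficient.\<close>

definition difference :: "(nat \<Rightarrow> nat) \<Rightarrow> nat \<Rightarrow> nat" where
  "difference p j = p j - p (j + 3)"

text \<open>\<open>b_coeff\<close> without its factor \<open>m / (p 1 + p 2)\<close>; as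
  coefficients of \<zeta>^m q^n these numbers expand 1/\<Phi>.\<close>

definition multinomial_sum :: "nat \<Rightarrow> nat \<Rightarrow> real" where
  "multinomial_sum n m = (\<Sum>p\<in>Omega n m. (-1) ^ (m + p 2) *
     multinomial (p 1 + p 2) {j\<in>{1..n}. \<not> 3 dvd j} (\<lambda>j. p j - p (j + 3)))"

lemma pent_add_3: "pent (e + 3) = pent e + (e + 2)"
proof -
  have "(e + 3) * (e + 3 + 1) = (e + 2) * 6 + e * (e + 1)"
    by (simp add: algebra_simps)
  moreover have "((e + 2) * 6 + e * (e + 1)) div 6 = e + 2 + e * (e + 1) div 6"
    by (rule div_mult_self3) simp
  ultimately show ?thesis
    unfolding pent_def by linarith
qed

text \<open>For \<open>j \<ge> 1\<close> the numbers \<open>3*j-2\<close> and \<open>3*j-1\<close>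
  are exactly the positive integers prime to 3, so the two families of inequalities merge into one
  that is uniform in the residue class.\<close>

lemma Omega_chain:
  fixes p :: "nat \<Rightarrow> nat"
  shows "(\<forall>j\<ge>1. p (3*j-2) \<ge> p (3*j+1) \<and> p (3*j-1) \<ge> p (3*j+2) \<and> p (3*j) = 0) \<longleftrightarrow>
   (\<forall>j\<ge>1. 3 dvd j \<longrightarrow> p j = 0) \<and> (\<forall>j. \<not> 3 dvd j \<longrightarrow> p (j + 3) \<le> p j)"
proof safe
  fix j :: nat assume "3 dvd j" "j \<ge> 1" "\<forall>j\<ge>1. p (3*j-2) \<ge> p (3*j+1) \<and> p (3*j-1) \<ge> p (3*j+2) \<and> p (3*j) = 0"
  then show "p j = 0" by (auto elim!: dvdE)
next
  fix j :: nat
  assume j: "\<not> 3 dvd j" and *: "\<forall>j\<ge>1. p (3*j-2) \<ge> p (3*j+1) \<and> p (3*j-1) \<ge> p (3*j+2) \<and> p (3*j) = 0"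
  have "j mod 3 = 1 \<or> j mod 3 = 2" using j by presburger
  then show "p (j + 3) \<le> p j"
  proof
    assume "j mod 3 = 1"
    then have "j = 3 * (j div 3 + 1) - 2" "j + 3 = 3 * (j div 3 + 1) + 1" by presburger+
    then show ?thesis using * by (metis le_add2)
  next
    assume "j mod 3 = 2"
    then have "j = 3 * (j div 3 + 1) - 1" "j + 3 = 3 * (j div 3 + 1) + 2" by presburger+
    then show ?thesis using * by (metis le_add2)
  qed
next
  fix j :: nat
  assume j: "j \<ge> 1" and *: "\<forall>j. \<not> 3 dvd j \<longrightarrow> p (j + 3) \<le> p j"
  have "\<not> 3 dvd (3*j-2)" "\<not> 3 dvd (3*j-1)" "3*j-2+3 = 3*j+1" "3*j-1+3 = 3*j+2"
    using j by presburger+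
  then show "p (3*j-2) \<ge> p (3*j+1)" "p (3*j-1) \<ge> p (3*j+2)"
    using * by metis+
qed auto

text \<open>The free cutoff \<open>K\<close> allows partitions of different sizes to be compared
  over one summation range, as adding a column requires. Parts equal to 0 are excluded by the clause
  for multiples of 3, which includes \<open>j = 0\<close>.\<close>

lemma Omega_iff:
  assumes "n \<le> K"
  shows "p \<in> Omega n m \<longleftrightarrow>
    (\<forall>j. 3 dvd j \<longrightarrow> p j = 0) \<and> (\<forall>j>K. p j = 0) \<and> (\<forall>j. \<not> 3 dvd j \<longrightarrow> p (j + 3) \<le> p j) \<and>
    (\<Sum>j\<le>K. j * p j) = n \<and> 3 * (\<Sum>j\<le>K. p j) = m + p 1"
    (is "_ \<longleftrightarrow> ?R")
proof -
  have sums: "(\<Sum>j\<le>K. f j) = (\<Sum>j=1..n. f j)"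
    if "\<And>j. p j = 0 \<Longrightarrow> f j = 0" "\<forall>j. p j \<noteq> 0 \<longrightarrow> 1 \<le> j \<and> j \<le> n" for f :: "nat \<Rightarrow> nat"
    using assms that by (intro sum.mono_neutral_right) fastforce+
  show ?thesis
  proof
    assume p: "p \<in> Omega n m"
    then have supp: "\<forall>j. p j \<noteq> 0 \<longrightarrow> 1 \<le> j \<and> j \<le> n"
      by (auto simp: Omega_def is_partition_def)
    have "(\<forall>j\<ge>1. 3 dvd j \<longrightarrow> p j = 0) \<and> (\<forall>j. \<not> 3 dvd j \<longrightarrow> p (j + 3) \<le> p j)"
      using p unfolding Omega_def Omega_chain by blast
    moreover have "p 0 = 0" using supp by fastforce
    ultimately have "(\<forall>j. 3 dvd j \<longrightarrow> p j = 0) \<and> (\<forall>j. \<not> 3 dvd j \<longrightarrow> p (j + 3) \<le> p j)"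
      by (metis One_nat_def Suc_leI gr0I)
    moreover have "\<forall>j>K. p j = 0" using supp assms by fastforce
    moreover have "(\<Sum>j\<le>K. j * p j) = n" "3 * (\<Sum>j\<le>K. p j) = m + p 1"
      using p sums[of "\<lambda>j. j * p j"] sums[of p] supp
      by (simp_all add: Omega_def is_partition_def partition_length_def)
    ultimately show ?R by blast
  next
    assume R: ?R
    have supp: "\<forall>j. p j \<noteq> 0 \<longrightarrow> 1 \<le> j \<and> j \<le> n"
    proof (intro allI impI conjI)
      fix j assume pj: "p j \<noteq> 0"
      then have "j \<noteq> 0" using R by (metis dvd_0_right)
      then show "1 \<le> j" by simp
      have "j \<le> K" using R pj by (meson not_le)
      then have "j * p j \<le> (\<Sum>j\<le>K. j * p j)" by (intro member_le_sum) auto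
      then have "j * p j \<le> n" using R by simp
      moreover have "j \<le> j * p j" using pj by simp
      ultimately show "j \<le> n" by linarith
    qed
    then show "p \<in> Omega n m"
      using R sums[of "\<lambda>j. j * p j"] sums[of p]
      unfolding Omega_def Omega_chain mem_Collect_eq is_partition_def partition_length_def
      by auto
  qed
qed

lemma mod_3_eq_imp:
  assumes "j mod 3 = i mod (3::nat)" "i < j" "j \<le> i + 3"
  shows "j = i + 3"
proof -
  have "3 dvd j - i" using assms by (simp add: mod_eq_dvd_iff_nat)
  then have "3 \<le> j - i" using assms by (intro dvd_imp_le) auto
  then show ?thesis using assms by simp
qed

lemma residue_column_add_3: "residue_column (i + 3) j = residue_column i j + (if j = i + 3 then 1 else 0)"
proof (cases "j mod 3 = i mod 3 \<and> i < j \<and> j \<le> i + 3")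
  case True
  then show ?thesis using mod_3_eq_imp[of j i] by (auto simp: residue_column_def)
qed (auto simp: residue_column_def)

text \<open>Induction in steps of 3 from the one-part columns with tops 1 and 2; by
  \<open>pent_add_3\<close>, \<open>pent (i + 1)\<close> grows by exactly the new top part.\<close>

lemma residue_column_sums:
  assumes "\<not> 3 dvd i" "i \<le> K"
  shows "(\<Sum>j\<le>K. residue_column i j) = i div 3 + 1 \<and> (\<Sum>j\<le>K. j * residue_column i j) = pent (i + 1)"
  using assms
proof (induction i rule: less_induct)
  case (less i)
  have "i = 1 \<or> i = 2 \<or> (i = i - 3 + 3 \<and> \<not> 3 dvd (i - 3))" using less.prems by presburger
  then consider "i = 1" | "i = 2" | k where "i = k + 3" "\<not> 3 dvd k" by blast
  then show ?case
  proof cases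
    case 1
    have "residue_column i j = (if j = 1 then 1 else 0)" for j
      using 1 by (auto simp: residue_column_def)
    then have "residue_column i = (\<lambda>j. if j = 1 then 1 else 0)" by blast
    then show ?thesis using less.prems 1 by (simp add: pent_def if_distrib cong: if_cong)
  next
    case 2
    have "residue_column i j = (if j = 2 then 1 else 0)" for j
    proof -
      have "(1 \<le> j \<and> j \<le> 2 \<and> j mod 3 = 2 mod 3) = (j = 2)" by presburger
      then show ?thesis by (simp add: residue_column_def 2)
    qed
    then have "residue_column i = (\<lambda>j. if j = 2 then 1 else 0)" by blast
    then show ?thesis using less.prems 2 by (simp add: pent_def if_distrib cong: if_cong)
  next
    case (3 k)
    have "(\<Sum>j\<le>K. residue_column k j) = k div 3 + 1" "(\<Sum>j\<le>K. j * residue_column k j) = pent (k + 1)"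
      using less.IH[of k] less.prems 3 by auto
    moreover have "pent (k + 1 + 3) = pent (k + 1) + (k + 3)"
      using pent_add_3[of "k + 1"] by simp
    moreover have "(\<Sum>j\<le>K. residue_column i j) = (\<Sum>j\<le>K. residue_column k j) + 1"
      using less.prems 3 by (simp only: residue_column_add_3 sum.distrib) simp
    moreover have "(\<Sum>j\<le>K. j * (if j = i then 1 else 0)) = i"
      using less.prems by (simp add: if_distrib cong: if_cong)
    then have "(\<Sum>j\<le>K. j * residue_column i j) = (\<Sum>j\<le>K. j * residue_column k j) + i"
      using 3 by (simp only: residue_column_add_3 sum.distrib distrib_left)
    ultimately show ?thesis using 3 by simp
  qed
qed

text \<open>A column ends in either 1 or 2, so it raises the upper multinomial entry
  \<open>p 1 + p 2\<close> by one; it raises \<open>m\<close>, which is three times the length minus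
  \<open>p 1\<close>, by \<open>i + 1\<close>.\<close>

lemma residue_column_sum_ends:
  assumes "\<not> 3 dvd i"
  shows "residue_column i 1 + residue_column i 2 = 1" "3 * (i div 3 + 1) = i + 1 + residue_column i 1"
proof -
  have "i mod 3 = 1 \<or> i mod 3 = 2" "i \<noteq> 0" using assms by presburger+
  then show "residue_column i 1 + residue_column i 2 = 1" by (auto simp: residue_column_def)
  have "3 * (i div 3) + i mod 3 = i" by presburger
  with \<open>i mod 3 = 1 \<or> i mod 3 = 2\<close> show "3 * (i div 3 + 1) = i + 1 + residue_column i 1"
    using \<open>i \<noteq> 0\<close> by (elim disjE) (simp_all add: residue_column_def)
qed

text \<open>Along its residue class the indicator of a column drops only after the top part
  \<open>i\<close>; adding the column therefore changes only the difference at
  \<open>i\<close>.\<close>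

lemma residue_column_step:
  assumes "\<not> 3 dvd i" "\<not> 3 dvd j"
  shows "residue_column i j = residue_column i (j + 3) + (if j = i then 1 else 0)"
proof (cases "j \<le> i")
  case True
  moreover have "0 < j" "0 < i" using assms by (auto intro: Nat.gr0I)
  moreover have "j \<noteq> i \<Longrightarrow> j mod 3 = i mod 3 \<Longrightarrow> j + 3 \<le> i"
    using mod_3_eq_imp[of i j] True by (cases "i \<le> j + 3") auto
  ultimately show ?thesis by (auto simp: residue_column_def)
qed (auto simp: residue_column_def)

lemma difference_add_column:
  assumes "\<not> 3 dvd i" "\<not> 3 dvd j" "p (j + 3) \<le> p j"
  shows "difference (\<lambda>j. p j + residue_column i j) j = difference p j + (if j = i then 1 else 0)"
  using residue_column_step[OF assms(1,2)] assms(3) by (simp add: difference_def)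

text \<open>An equivalence, so that it serves both to add and to remove a column. The column weakens
  the chain condition only at \<open>j = i\<close>, by one unit, and positivity of the new
  difference at \<open>i\<close> restores precisely this case.\<close>

lemma add_column_mem_Omega_iff:
  assumes i: "\<not> 3 dvd i" "i \<le> K" and n: "n + pent (i + 1) \<le> K"
  shows "(\<lambda>j. p j + residue_column i j) \<in> Omega (n + pent (i + 1)) (m + (i + 1)) \<and>
      difference (\<lambda>j. p j + residue_column i j) i > 0 \<longleftrightarrow> p \<in> Omega n m" (is "?p \<in> _ \<and> _ \<longleftrightarrow> _")
proof -
  have c3: "(\<forall>j. 3 dvd j \<longrightarrow> ?p j = 0) \<longleftrightarrow> (\<forall>j. 3 dvd j \<longrightarrow> p j = 0)"
    using i(1) unfolding residue_column_def by (auto simp: dvd_eq_mod_eq_0)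
  have cK: "(\<forall>j>K. ?p j = 0) \<longleftrightarrow> (\<forall>j>K. p j = 0)"
    using i(2) by (auto simp: residue_column_def)
  have s1: "(\<Sum>j\<le>K. j * ?p j) = (\<Sum>j\<le>K. j * p j) + pent (i + 1)"
    using residue_column_sums[OF i] by (simp only: sum.distrib distrib_left)
  have "(\<Sum>j\<le>K. ?p j) = (\<Sum>j\<le>K. p j) + (i div 3 + 1)"
    using residue_column_sums[OF i] by (simp only: sum.distrib)
  then have s2: "3 * (\<Sum>j\<le>K. ?p j) = m + (i + 1) + ?p 1 \<longleftrightarrow> 3 * (\<Sum>j\<le>K. p j) = m + p 1"
    using residue_column_sum_ends(2)[OF i(1)] by (auto simp only: distrib_left[of 3 "sum p {..K}"])
  have iff: "?p (j + 3) \<le> ?p j \<longleftrightarrow> p (j + 3) \<le> p j + (if j = i then 1 else 0)" if "\<not> 3 dvd j" for j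
    using residue_column_step[OF i(1) that] by linarith
  have pos: "difference ?p i > 0 \<longleftrightarrow> p (i + 3) \<le> p i"
    using residue_column_step[OF i(1) i(1)] by (simp add: difference_def) linarith
  have chain: "(\<forall>j. \<not> 3 dvd j \<longrightarrow> ?p (j + 3) \<le> ?p j) \<and> difference ?p i > 0 \<longleftrightarrow>
      (\<forall>j. \<not> 3 dvd j \<longrightarrow> p (j + 3) \<le> p j)" (is "?L \<longleftrightarrow> ?R")
  proof
    assume L: ?L
    show ?R
    proof (intro allI impI)
      fix j :: nat assume j: "\<not> 3 dvd j"
      show "p (j + 3) \<le> p j"
      proof (cases "j = i")
        case True
        then show ?thesis using L pos by blast
      next
        case False
        then show ?thesis using L iff[OF j] j by simp
      qed
    qed
  next
    assume R: ?R
    then have "?p (j + 3) \<le> ?p j" if "\<not> 3 dvd j" for j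
      using iff[OF that] that by (simp add: trans_le_add1)
    then show ?L using R pos i(1) by blast
  qed
  have "n \<le> K" using n by simp
  show ?thesis
    unfolding Omega_iff[OF n] Omega_iff[OF \<open>n \<le> K\<close>] c3 cK s1 s2 chain[symmetric] by auto
qed

text \<open>Summation by parts in steps of 3, over \<open>int\<close> because
  \<open>f i - f (i - 3)\<close> may be negative. As \<open>p\<close> vanishes beyond
  \<open>K\<close>, extending the range to \<open>K + 3\<close> absorbs the boundary term of the
  shift.\<close>

lemma Omega_sum_difference:
  assumes "p \<in> Omega n m" and K: "n \<le> K"
  shows "(\<Sum>i\<in>{i\<in>{..K}. \<not> 3 dvd i}. f i * int (difference p i)) =
    (\<Sum>i\<le>K + 3. (if 3 \<le> i then f i - f (i - 3) else f i) * int (p i))"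
proof -
  have p: "\<And>j. 3 dvd j \<Longrightarrow> p j = 0" "\<And>j. j > K \<Longrightarrow> p j = 0"
    "\<And>j. \<not> 3 dvd j \<Longrightarrow> p (j + 3) \<le> p j"
    using assms(1) unfolding Omega_iff[OF K] by auto
  have shift: "(\<Sum>i\<le>K. g (i + 3)) = (\<Sum>i\<le>K + 3. if 3 \<le> i then g i else 0)" for g :: "nat \<Rightarrow> int"
    by (induction K) (simp_all add: numeral_3_eq_3)
  have "(\<Sum>i\<in>{i\<in>{..K}. \<not> 3 dvd i}. f i * int (difference p i)) =
      (\<Sum>i\<in>{i\<in>{..K}. \<not> 3 dvd i}. f i * int (p i) - f i * int (p (i + 3)))"
    using p(3) by (intro sum.cong) (auto simp: difference_def of_nat_diff algebra_simps)
  also have "\<dots> = (\<Sum>i\<le>K. f i * int (p i) - f i * int (p (i + 3)))"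
    using p(1) by (intro sum.mono_neutral_left) (auto intro!: p(1))
  also have "\<dots> = (\<Sum>i\<le>K. f i * int (p i)) - (\<Sum>i\<le>K. f i * int (p (i + 3)))"
    by (rule sum_subtractf)
  also have "(\<Sum>i\<le>K. f i * int (p i)) = (\<Sum>i\<le>K + 3. f i * int (p i))"
    using p(2) by (intro sum.mono_neutral_left) auto
  also have "(\<Sum>i\<le>K. f i * int (p (i + 3))) =
      (\<Sum>i\<le>K + 3. if 3 \<le> i then f (i - 3) * int (p i) else 0)"
    using shift[of "\<lambda>i. f (i - 3) * int (p i)"] by simp
  finally show ?thesis
    by (simp add: sum_subtractf[symmetric] if_distrib algebra_simps cong: if_cong sum.cong)
      (rule sum.cong; simp add: algebra_simps)
qed

text \<open>The weights 1, \<open>i + 1\<close> and \<open>pent (i + 1)\<close> have 3-step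
  differences 0, 3 and \<open>i\<close>, so summation by parts turns them into
  \<open>p 1 + p 2\<close>, \<open>m\<close> and \<open>n\<close>.\<close>

lemma Omega_difference_sums:
  assumes "p \<in> Omega n m" and K: "n \<le> K"
  shows "(\<Sum>i\<in>{i\<in>{..K}. \<not> 3 dvd i}. difference p i) = p 1 + p 2" (is ?A)
    "(\<Sum>i\<in>{i\<in>{..K}. \<not> 3 dvd i}. (i + 1) * difference p i) = m" (is ?B)
    "(\<Sum>i\<in>{i\<in>{..K}. \<not> 3 dvd i}. pent (i + 1) * difference p i) = n" (is ?C)
proof -
  have p: "p 0 = 0" "\<And>j. j > K \<Longrightarrow> p j = 0" "(\<Sum>j\<le>K. j * p j) = n" "3 * (\<Sum>j\<le>K. p j) = m + p 1"
    using assms(1) unfolding Omega_iff[OF K] by auto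
  have ext: "(\<Sum>j\<le>K + 3. h j * p j) = (\<Sum>j\<le>K. h j * p j)" for h
    using p(2) by (intro sum.mono_neutral_right) auto
  have low: "(\<Sum>i\<le>K + 3. if 3 \<le> i then 0 else g i) = g 0 + g 1 + g 2" for g :: "nat \<Rightarrow> int"
    by (induction K) (simp_all add: numeral_3_eq_3 numeral_2_eq_2)
  have "int (\<Sum>i\<in>{i\<in>{..K}. \<not> 3 dvd i}. difference p i) =
      (\<Sum>i\<le>K + 3. if 3 \<le> i then 0 else int (p i))"
    using Omega_sum_difference[OF assms, of "\<lambda>_. 1"] by (simp add: if_distrib if_distribR cong: if_cong)
  also have "\<dots> = int (p 1 + p 2)" unfolding low using p(1) by simp
  finally show ?A by (simp only: of_nat_eq_iff)
  \<comment> \<open>Below 3 the weight \<open>i + 1\<close> is 3 minus \<open>2 - i\<close>; since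
    \<open>p 0 = 0\<close>, only \<open>i = 1\<close> leaves a correction, namely
    \<open>p 1\<close>.\<close>
  have "int (\<Sum>i\<in>{i\<in>{..K}. \<not> 3 dvd i}. (i + 1) * difference p i) =
      (\<Sum>i\<le>K + 3. 3 * int (p i) - (if 3 \<le> i then 0 else (2 - int i) * int (p i)))"
    using Omega_sum_difference[OF assms, of "\<lambda>i. int (i + 1)"]
    by (simp add: algebra_simps if_distrib if_distribR cong: if_cong)
  also have "\<dots> = 3 * int (\<Sum>i\<le>K. p i) - int (p 1)"
    unfolding sum_subtractf low using ext[of "\<lambda>_. 1"] p(1)
    by (simp add: sum_distrib_left[symmetric] flip: of_nat_sum)
  finally show ?B using p(4) by linarith
  have "int (\<Sum>i\<in>{i\<in>{..K}. \<not> 3 dvd i}. pent (i + 1) * difference p i) = (\<Sum>i\<le>K + 3. int i * int (p i))"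
  proof -
    have "(if 3 \<le> i then int (pent (i + 1)) - int (pent (i - 3 + 1)) else int (pent (i + 1))) = int i" for i
    proof (cases "3 \<le> i")
      case True
      then show ?thesis using pent_add_3[of "i - 3 + 1"] by simp
    next
      case False
      then have "i = 0 \<or> i = 1 \<or> i = 2" by auto
      then show ?thesis by (auto simp: pent_def)
    qed
    then show ?thesis
      using Omega_sum_difference[OF assms, of "\<lambda>i. int (pent (i + 1))"] by simp
  qed
  also have "\<dots> = int n" using ext[of "\<lambda>i. i"] p(3) by (simp flip: of_nat_mult of_nat_sum)
  finally show ?C by (simp only: of_nat_eq_iff)
qed

text \<open>Multiplicities do not increase up a residue class, so a part \<open>i\<close> forces a
  copy of every part of its column; the truncated subtraction of the column is then exact.\<close>

lemma residue_column_le: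
  assumes p: "\<And>j. \<not> 3 dvd j \<Longrightarrow> p (j + 3) \<le> p j" and i: "\<not> 3 dvd i" "p i > 0"
  shows "residue_column i j \<le> p j"
proof (cases "j mod 3 = i mod 3 \<and> j \<le> i")
  case True
  have "\<not> 3 dvd j" using True i by presburger
  then have le: "p (j + 3 * k) \<le> p j" for k
  proof (induction k)
    case (Suc k)
    have "\<not> 3 dvd (j + 3 * k)" using Suc.prems by presburger
    from p[OF this] have "p (j + 3 * Suc k) \<le> p (j + 3 * k)" by (simp add: algebra_simps)
    then show ?case using Suc by simp
  qed simp
  have "3 dvd i - j" using True mod_eq_dvd_iff_nat[of j i 3] by simp
  then obtain k where "i - j = 3 * k" by (elim dvdE)
  then have "i = j + 3 * k" using True by linarith
  then have "p j > 0" using le[of k] i by simp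
  then show ?thesis by (simp add: residue_column_def)
qed (auto simp: residue_column_def)

text \<open>The left exponent is what a column adds to \<open>m + p 2\<close>. The minus sign on the
  right is the one in the geometric series 1/\<Phi> = 1/(1 - (1 - \<Phi>)).\<close>

lemma theta_sign_column:
  assumes "\<not> 3 dvd i"
  shows "(-1) ^ (i + 1 + residue_column i 2) = - theta_sign (i + 1)"
proof -
  consider t where "i = 3 * t + 1" | t where "i = 3 * t + 2"
  proof -
    have "i = 3 * (i div 3) + 1 \<or> i = 3 * (i div 3) + 2" using assms by presburger
    then show ?thesis using that by blast
  qed
  then show ?thesis
  proof cases
    case 1
    have "(3 * t + 2) mod 3 = 2" "(3 * t + 2) div 3 = t" by presburger+
    then show ?thesis using 1 by (simp add: theta_sign_def residue_column_def power_add power_mult)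
  next
    case 2
    have "(3 * t + 3) mod 3 = 0" "(3 * t + 3) div 3 = t + 1" "(3 * t + 2) mod 3 = 2" by presburger+
    moreover from this have "residue_column i 2 = 1" by (simp only: residue_column_def 2) simp
    ultimately show ?thesis using 2 by (simp add: theta_sign_def power_add power_mult)
  qed
qed

section \<open>Multinomial coefficients under removal of one column, and the resulting
  recursions\<close>

lemma multinomial_difference_superset:
  assumes "p \<in> Omega n m" "n \<le> K"
  shows "multinomial N {j\<in>{1..n}. \<not> 3 dvd j} (difference p) = multinomial N {j\<in>{1..K}. \<not> 3 dvd j} (difference p)"
proof -
  have "\<forall>j>n. p j = 0" using assms Omega_iff[of n n p m] by auto
  then have "fact (difference p j) = (1::real)" if "\<not> j \<le> n" for j
    using that by (simp add: difference_def)
  then have "(\<Prod>j\<in>{j\<in>{1..n}. \<not> 3 dvd j}. fact (difference p j) :: real) =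
      (\<Prod>j\<in>{j\<in>{1..K}. \<not> 3 dvd j}. fact (difference p j))"
    using assms(2) by (intro prod.mono_neutral_left) auto
  then show ?thesis by (simp add: multinomial_def)
qed

text \<open>The absorption identity: with N the upper entry and a the lower entries after adding the
  column, multiplying by a_i/N lowers both N and a_i by one.\<close>

lemma multinomial_add_column:
  fixes p i
  defines "p' \<equiv> \<lambda>j. p j + residue_column i j"
  assumes p: "\<And>j. \<not> 3 dvd j \<Longrightarrow> p (j + 3) \<le> p j" and i: "\<not> 3 dvd i" "i \<in> {1..K}"
  shows "multinomial (p' 1 + p' 2) {j\<in>{1..K}. \<not> 3 dvd j} (difference p') * difference p' i / (p' 1 + p' 2) =
    multinomial (p 1 + p 2) {j\<in>{1..K}. \<not> 3 dvd j} (difference p)"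
proof -
  let ?J = "{j\<in>{1..K}. \<not> 3 dvd j}"
  have d: "difference p' j = difference p j + (if j = i then 1 else 0)" if "\<not> 3 dvd j" for j
    unfolding p'_def using i that p by (intro difference_add_column)
  have N: "p' 1 + p' 2 = Suc (p 1 + p 2)"
    using residue_column_sum_ends(1)[OF i(1)] by (simp add: p'_def)
  have iJ: "i \<in> ?J" "finite ?J" using i by auto
  have "(\<Prod>j\<in>?J. fact (difference p' j) :: real) = fact (difference p' i) * (\<Prod>j\<in>?J - {i}. fact (difference p' j))"
    using iJ by (intro prod.remove)
  also have "(\<Prod>j\<in>?J - {i}. fact (difference p' j) :: real) = (\<Prod>j\<in>?J - {i}. fact (difference p j))"
    using d by (intro prod.cong) auto
  also have "fact (difference p' i) = (of_nat (difference p' i) * fact (difference p i) :: real)"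
    using d[OF i(1)] by simp
  also have "\<dots> * (\<Prod>j\<in>?J - {i}. fact (difference p j)) = of_nat (difference p' i) * (\<Prod>j\<in>?J. fact (difference p j))"
    using iJ prod.remove[of ?J i "\<lambda>j. fact (difference p j) :: real"] by simp
  finally have *: "(\<Prod>j\<in>?J. fact (difference p' j) :: real) = real (difference p' i) * (\<Prod>j\<in>?J. fact (difference p j))" .
  have "difference p' i > 0" using d[OF i(1)] by simp
  moreover have "(\<Prod>j\<in>?J. fact (difference p j) :: real) \<noteq> 0" by simp
  ultimately show ?thesis
    unfolding multinomial_def * N fact_Suc by (simp add: field_simps del: of_nat_Suc)
qed

text \<open>Adding and subtracting the column are mutually inverse bijections: a positive difference
  at \<open>i\<close> places the whole column inside \<open>p\<close>.\<close>

lemma Omega_sum_remove_column: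
  assumes i: "\<not> 3 dvd i" and n: "pent (i + 1) \<le> n" "i \<le> n" and m: "i + 1 \<le> m"
  shows "(\<Sum>p\<in>{p\<in>Omega n m. difference p i > 0}. g p) =
    (\<Sum>p\<in>Omega (n - pent (i + 1)) (m - (i + 1)). g (\<lambda>j. p j + residue_column i j))"
proof -
  have nm: "n - pent (i + 1) + pent (i + 1) = n" "m - (i + 1) + (i + 1) = m" using n m by auto
  note iff = add_column_mem_Omega_iff[of i n "n - pent (i + 1)" _ "m - (i + 1)", unfolded nm, OF i n(2) order.refl]
  have inv: "(\<lambda>j. p j - residue_column i j + residue_column i j) = p" if "p \<in> Omega n m" "difference p i > 0" for p
  proof -
    have "p i > 0" using that by (simp add: difference_def)
    then have "residue_column i j \<le> p j" for j
      using Omega_iff[OF order.refl, of p n m] that i by (intro residue_column_le) auto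
    then show ?thesis by auto
  qed
  show ?thesis
  proof (rule sum.reindex_bij_witness[of _ "\<lambda>p j. p j + residue_column i j" "\<lambda>p j. p j - residue_column i j"])
    fix p assume p: "p \<in> {p\<in>Omega n m. difference p i > 0}"
    show "(\<lambda>j. p j - residue_column i j + residue_column i j) = p" using inv p by simp
    show "(\<lambda>j. p j - residue_column i j) \<in> Omega (n - pent (i + 1)) (m - (i + 1))"
      using iff[of "\<lambda>j. p j - residue_column i j"] inv p by simp
    show "g (\<lambda>j. p j - residue_column i j + residue_column i j) = g p" using inv p by simp
  next
    fix p assume p: "p \<in> Omega (n - pent (i + 1)) (m - (i + 1))"
    show "(\<lambda>j. p j + residue_column i j - residue_column i j) = p" by simp
    show "(\<lambda>j. p j + residue_column i j) \<in> {p\<in>Omega n m. difference p i > 0}" using iff[of p] p by simp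
  qed
qed

text \<open>A column contains its top part. So the top of any column of size at most
  \<open>n\<close> is found in \<open>{..n}\<close>.\<close>

lemma le_pent_Suc: "\<not> 3 dvd i \<Longrightarrow> i \<le> pent (i + 1)"
proof (induction i rule: less_induct)
  case (less i)
  have "i = 1 \<or> i = 2 \<or> (i = i - 3 + 3 \<and> \<not> 3 dvd (i - 3))" using less.prems by presburger
  then consider "i = 1" | "i = 2" | k where "i = k + 3" "\<not> 3 dvd k" by blast
  then show ?case
  proof cases
    case (3 k)
    then show ?thesis using pent_add_3[of "k + 1"] by simp
  qed (auto simp: pent_def)
qed

lemma Omega_difference_pos_le:
  assumes p: "p \<in> Omega n m" and i: "\<not> 3 dvd i" "difference p i > 0"
  shows "i + 1 \<le> m" "pent (i + 1) \<le> n" "i \<le> n"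
proof -
  have le: "x \<le> x * difference p i" for x using i by simp
  have "p i > 0" using i by (simp add: difference_def)
  then show "i \<le> n" using p Omega_iff[OF order.refl, of p n m] by (metis not_le less_irrefl)
  then have mem: "i \<in> {i\<in>{..n}. \<not> 3 dvd i}" using i by simp
  have "(i + 1) * difference p i \<le> (\<Sum>i\<in>{i\<in>{..n}. \<not> 3 dvd i}. (i + 1) * difference p i)"
    using mem by (intro member_le_sum[where f = "\<lambda>i. (i + 1) * difference p i"]) auto
  with le[of "i + 1"] show "i + 1 \<le> m" using Omega_difference_sums(2)[OF p order.refl] by linarith
  have "pent (i + 1) * difference p i \<le> (\<Sum>i\<in>{i\<in>{..n}. \<not> 3 dvd i}. pent (i + 1) * difference p i)"
    using mem by (intro member_le_sum[where f = "\<lambda>i. pent (i + 1) * difference p i"]) auto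
  with le[of "pent (i + 1)"] show "pent (i + 1) \<le> n" using Omega_difference_sums(3)[OF p order.refl] by linarith
qed

lemma multinomial_sum_difference:
  "multinomial_sum n m = (\<Sum>p\<in>Omega n m. (-1) ^ (m + p 2) *
     multinomial (p 1 + p 2) {j\<in>{1..n}. \<not> 3 dvd j} (difference p))"
  unfolding multinomial_sum_def difference_def ..

text \<open>The common source of the recursions: weight each term by a sum over the columns of the
  partition, interchange the sums and delete one column of each kind;
  \<open>multinomial_add_column\<close> absorbs the division by \<open>p 1 + p 2\<close>. The
  weights 1, \<open>e\<close> and \<open>pent e\<close> give the recursions for
  \<open>multinomial_sum n m\<close>, \<open>b_coeff n m\<close> and
  \<open>n * (b_coeff n m / m)\<close>. As \<open>e = i + 1\<close>, the index starts at 2.\<close>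

lemma Omega_sum_columns:
  fixes f :: "nat \<Rightarrow> real"
  shows "(\<Sum>p\<in>Omega n m. (-1) ^ (m + p 2) / real (p 1 + p 2) *
      multinomial (p 1 + p 2) {j\<in>{1..n}. \<not> 3 dvd j} (difference p) *
      (\<Sum>i\<in>{i\<in>{..n}. \<not> 3 dvd i}. f (i + 1) * difference p i)) =
    - (\<Sum>e | 2 \<le> e \<and> e \<le> m \<and> pent e \<le> n. theta_sign e * f e * multinomial_sum (n - pent e) (m - e))"
proof -
  define J where "J = {i\<in>{..n}. \<not> 3 dvd i}"
  define w where "w p = (-1) ^ (m + p 2) / real (p 1 + p 2) *
      multinomial (p 1 + p 2) {j\<in>{1..n}. \<not> 3 dvd j} (difference p)" for p
  define s where "s e = theta_sign e * f e * multinomial_sum (n - pent e) (m - e)" for e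
  have inner: "(\<Sum>p\<in>Omega n m. w p * difference p i) =
      - (theta_sign (i+1) * multinomial_sum (n - pent (i+1)) (m - (i+1)))"
    if i: "\<not> 3 dvd i" "i + 1 \<le> m" "pent (i + 1) \<le> n" for i
  proof -
    have "i \<le> n" using le_pent_Suc[OF i(1)] i by simp
    moreover have "i \<noteq> 0" using i by (auto intro: Nat.gr0I)
    ultimately have iK: "i \<in> {1..n}" by simp
    have "(\<Sum>p\<in>Omega n m. w p * difference p i) = (\<Sum>p\<in>{p\<in>Omega n m. difference p i > 0}. w p * difference p i)"
      by (intro sum.mono_neutral_right) (auto simp: finite_Omega)
    also have "\<dots> = (\<Sum>p\<in>Omega (n - pent (i + 1)) (m - (i + 1)).
        w (\<lambda>j. p j + residue_column i j) * difference (\<lambda>j. p j + residue_column i j) i)"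
      using i \<open>i \<le> n\<close> by (intro Omega_sum_remove_column)
    also have "\<dots> = (\<Sum>p\<in>Omega (n - pent (i + 1)) (m - (i + 1)).
        - (theta_sign (i+1) * ((-1) ^ (m - (i + 1) + p 2) *
     multinomial (p 1 + p 2) {j\<in>{1..n - pent (i + 1)}. \<not> 3 dvd j} (difference p))))"
    proof (rule sum.cong[OF refl])
      fix p assume p: "p \<in> Omega (n - pent (i + 1)) (m - (i + 1))"
      have chain: "\<And>j. \<not> 3 dvd j \<Longrightarrow> p (j + 3) \<le> p j"
        using Omega_iff[OF order.refl] p by blast
      have "m + (p 2 + residue_column i 2) = (m - (i + 1) + p 2) + (i + 1 + residue_column i 2)" using i by simp
      then have "(-1::real) ^ (m + (p 2 + residue_column i 2)) =
          (-1) ^ (m - (i + 1) + p 2) * (-1) ^ (i + 1 + residue_column i 2)"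
        by (simp only: power_add)
      also have "(-1::real) ^ (i + 1 + residue_column i 2) = - theta_sign (i + 1)"
        by (rule theta_sign_column[OF i(1)])
      finally have sign: "(-1::real) ^ (m + (p 2 + residue_column i 2)) =
          (-1) ^ (m - (i + 1) + p 2) * - theta_sign (i + 1)" by simp
      have "w (\<lambda>j. p j + residue_column i j) * difference (\<lambda>j. p j + residue_column i j) i =
          (-1) ^ (m + (p 2 + residue_column i 2)) *
          (multinomial (p 1 + residue_column i 1 + (p 2 + residue_column i 2)) {j\<in>{1..n}. \<not> 3 dvd j}
            (difference (\<lambda>j. p j + residue_column i j)) * difference (\<lambda>j. p j + residue_column i j) i /
            (p 1 + residue_column i 1 + (p 2 + residue_column i 2)))"
        by (simp add: w_def)
      also have "multinomial (p 1 + residue_column i 1 + (p 2 + residue_column i 2)) {j\<in>{1..n}. \<not> 3 dvd j}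
            (difference (\<lambda>j. p j + residue_column i j)) * difference (\<lambda>j. p j + residue_column i j) i /
            (p 1 + residue_column i 1 + (p 2 + residue_column i 2)) =
          multinomial (p 1 + p 2) {j\<in>{1..n}. \<not> 3 dvd j} (difference p)"
        by (rule multinomial_add_column) (use chain i iK in auto)
      finally show "w (\<lambda>j. p j + residue_column i j) * difference (\<lambda>j. p j + residue_column i j) i =
        - (theta_sign (i+1) * ((-1) ^ (m - (i + 1) + p 2) *
     multinomial (p 1 + p 2) {j\<in>{1..n - pent (i + 1)}. \<not> 3 dvd j} (difference p)))"
        unfolding multinomial_difference_superset[OF p diff_le_self]
        unfolding sign by simp
    qed
    also have "\<dots> = - (theta_sign (i+1) * multinomial_sum (n - pent (i+1)) (m - (i+1)))"
      by (simp only: multinomial_sum_difference sum_negf sum_distrib_left)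
    finally show ?thesis .
  qed
  have inner0: "(\<Sum>p\<in>Omega n m. w p * difference p i) = 0"
    if i: "\<not> 3 dvd i" "\<not> (i + 1 \<le> m \<and> pent (i + 1) \<le> n)" for i
  proof (rule sum.neutral, rule ballI)
    fix p assume "p \<in> Omega n m"
    then have "difference p i = 0" using Omega_difference_pos_le[of p n m i] i by auto
    then show "w p * difference p i = 0" by simp
  qed
  have "(\<Sum>p\<in>Omega n m. w p * (\<Sum>i\<in>J. f (i + 1) * difference p i)) =
      (\<Sum>i\<in>J. f (i + 1) * (\<Sum>p\<in>Omega n m. w p * difference p i))"
    unfolding sum_distrib_left by (subst sum.swap) (simp add: mult_ac)
  also have "\<dots> = (\<Sum>i\<in>J. if i + 1 \<le> m \<and> pent (i + 1) \<le> n then - s (i + 1) else 0)"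
  proof (rule sum.cong[OF refl])
    fix i assume "i \<in> J"
    then have "\<not> 3 dvd i" by (simp add: J_def)
    then show "f (i + 1) * (\<Sum>p\<in>Omega n m. w p * difference p i) =
        (if i + 1 \<le> m \<and> pent (i + 1) \<le> n then - s (i + 1) else 0)"
      using inner[of i] inner0[of i] by (auto simp: s_def)
  qed
  also have "\<dots> = (\<Sum>i\<in>{i\<in>J. i + 1 \<le> m \<and> pent (i + 1) \<le> n}. - s (i + 1))"
    by (intro sum.inter_filter[symmetric]) (simp add: J_def)
  also have "\<dots> = (\<Sum>e\<in>{e. 2 \<le> e \<and> e \<le> m \<and> pent e \<le> n \<and> e mod 3 \<noteq> 1}. - s e)"
  proof (rule sum.reindex_bij_witness[of _ "\<lambda>e. e - 1" "\<lambda>i. i + 1"])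
    fix i assume "i \<in> {i\<in>J. i + 1 \<le> m \<and> pent (i + 1) \<le> n}"
    then have i: "\<not> 3 dvd i" "i + 1 \<le> m" "pent (i + 1) \<le> n" by (auto simp: J_def)
    have "i \<noteq> 0" using i by (auto intro: Nat.gr0I)
    moreover have "(i + 1) mod 3 \<noteq> 1" using i by presburger
    ultimately show "i + 1 \<in> {e. 2 \<le> e \<and> e \<le> m \<and> pent e \<le> n \<and> e mod 3 \<noteq> 1}" using i by simp
  next
    fix e assume "e \<in> {e. 2 \<le> e \<and> e \<le> m \<and> pent e \<le> n \<and> e mod 3 \<noteq> 1}"
    then have e: "2 \<le> e" "e \<le> m" "pent e \<le> n" "e mod 3 \<noteq> 1" by auto
    then have "\<not> 3 dvd (e - 1)" by presburger
    moreover have "e - 1 \<le> n" using le_pent_Suc[OF \<open>\<not> 3 dvd (e - 1)\<close>] e by simp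
    ultimately show "e - 1 \<in> {i\<in>J. i + 1 \<le> m \<and> pent (i + 1) \<le> n}" using e by (simp add: J_def)
    show "e - 1 + 1 = e" using e by simp
  qed auto
  \<comment> \<open>The indices congruent to 1 mod 3 can be put back because their sign is
    0.\<close>
  also have "\<dots> = (\<Sum>e | 2 \<le> e \<and> e \<le> m \<and> pent e \<le> n. - s e)"
    by (rule sum.mono_neutral_left) (auto simp: s_def theta_sign_def intro: finite_subset[of _ "{..m}"])
  finally show ?thesis unfolding w_def s_def J_def sum_negf .
qed

lemma multinomial_sum_0: "multinomial_sum 0 m = (if m = 0 then 1 else 0)"
proof -
  have "Omega 0 m = (if m = 0 then {\<lambda>_. 0} else {})"
  proof -
    have "p \<in> Omega 0 m \<longleftrightarrow> m = 0 \<and> p = (\<lambda>_. 0)" for p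
    proof
      assume "p \<in> Omega 0 m"
      then have *: "\<And>j. 3 dvd j \<Longrightarrow> p j = 0" "\<And>j. j > 0 \<Longrightarrow> p j = 0" "3 * p 0 = m + p 1"
        unfolding Omega_iff[OF order.refl] by auto
      have "p j = 0" for j by (cases "j = 0") (auto intro: *)
      then show "m = 0 \<and> p = (\<lambda>_. 0)" using *(3) by auto
    next
      assume "m = 0 \<and> p = (\<lambda>_. 0)"
      then show "p \<in> Omega 0 m" unfolding Omega_iff[OF order.refl] by auto
    qed
    then show ?thesis by auto
  qed
  then show ?thesis by (simp add: multinomial_sum_def multinomial_def)
qed

lemma six_pent:
  assumes "theta_sign e \<noteq> 0"
  shows "6 * pent e = e * (e + 1)"
proof -
  have "e mod 3 \<noteq> 1" using assms by (auto simp: theta_sign_def split: if_splits)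
  then have "3 dvd e \<or> 3 dvd (e + 1)" by presburger
  then have "3 dvd e * (e + 1)" by (meson dvd_mult dvd_mult2)
  moreover have "2 dvd e * (e + 1)" by simp
  ultimately have "lcm 2 3 dvd e * (e + 1)" by (intro lcm_least)
  moreover have "lcm 2 3 = (6::nat)" by (simp add: lcm_nat_def)
  ultimately show ?thesis unfolding pent_def by simp
qed

text \<open>Responsible for the range \<open>m \<le> 2 * n\<close> in the theorem. It rests on
  \<open>e + 1 \<ge> 3\<close> for \<open>e \<ge> 2\<close>; the exception \<open>e = 1\<close> has
  sign 0.\<close>

lemma le_two_pent:
  assumes "theta_sign e \<noteq> 0"
  shows "e \<le> 2 * pent e"
proof (cases "2 \<le> e")
  case True
  then have "e * 3 \<le> e * (e + 1)" by (intro mult_le_mono) auto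
  then show ?thesis using six_pent[OF assms] by linarith
next
  case False
  then have "e = 0 \<or> e = 1" by auto
  then show ?thesis using assms by (auto simp: theta_sign_def)
qed

lemma Omega_sum_columns_cong:
  fixes f :: "nat \<Rightarrow> real"
  assumes "\<And>p. p \<in> Omega n m \<Longrightarrow> (\<Sum>i\<in>{i\<in>{..n}. \<not> 3 dvd i}. f (i + 1) * real (difference p i)) = c p"
  shows "(\<Sum>p\<in>Omega n m. (-1) ^ (m + p 2) / real (p 1 + p 2) *
      multinomial (p 1 + p 2) {j\<in>{1..n}. \<not> 3 dvd j} (difference p) * c p) =
    - (\<Sum>e | 2 \<le> e \<and> e \<le> m \<and> pent e \<le> n. theta_sign e * f e * multinomial_sum (n - pent e) (m - e))"
  unfolding Omega_sum_columns[symmetric] using assms by simp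

text \<open>With weight 1 the column sum is \<open>p 1 + p 2\<close> and cancels the denominator.
  For \<open>n > 0\<close> there is at least one column, so this denominator is not 0.\<close>

lemma multinomial_sum_rec:
  assumes "n > 0"
  shows "multinomial_sum n m =
    - (\<Sum>e | 2 \<le> e \<and> e \<le> m \<and> pent e \<le> n. theta_sign e * multinomial_sum (n - pent e) (m - e))"
proof -
  have pos: "p 1 + p 2 > 0" if p: "p \<in> Omega n m" for p
  proof (rule ccontr)
    assume "\<not> p 1 + p 2 > 0"
    then have "\<forall>i\<in>{i\<in>{..n}. \<not> 3 dvd i}. difference p i = 0"
      using Omega_difference_sums(1)[OF p order.refl] by (simp del: mem_Collect_eq)
    then show False using Omega_difference_sums(3)[OF p order.refl] assms by simp
  qed
  have "multinomial_sum n m = (\<Sum>p\<in>Omega n m. (-1) ^ (m + p 2) / real (p 1 + p 2) *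
      multinomial (p 1 + p 2) {j\<in>{1..n}. \<not> 3 dvd j} (difference p) * real (p 1 + p 2))"
    unfolding multinomial_sum_difference using pos by (intro sum.cong) force+
  also have "\<dots> = - (\<Sum>e | 2 \<le> e \<and> e \<le> m \<and> pent e \<le> n. theta_sign e * 1 * multinomial_sum (n - pent e) (m - e))"
    by (rule Omega_sum_columns_cong) (use Omega_difference_sums(1)[OF _ order.refl, of _ n m] in \<open>simp flip: of_nat_sum\<close>)
  finally show ?thesis by simp
qed

text \<open>With weight \<open>e\<close> the column sum is \<open>m\<close>, the numerator in
  \<open>b_coeff\<close>.\<close>

lemma b_coeff_multinomial_sum:
  "b_coeff n m =
    - (\<Sum>e | 2 \<le> e \<and> e \<le> m \<and> pent e \<le> n. theta_sign e * e * multinomial_sum (n - pent e) (m - e))"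
proof -
  have "b_coeff n m = (\<Sum>p\<in>Omega n m. (-1) ^ (m + p 2) / real (p 1 + p 2) *
      multinomial (p 1 + p 2) {j\<in>{1..n}. \<not> 3 dvd j} (difference p) * real m)"
    unfolding b_coeff_def difference_def by (intro sum.cong) (simp_all add: difference_def[abs_def])
  also have "\<dots> = - (\<Sum>e | 2 \<le> e \<and> e \<le> m \<and> pent e \<le> n. theta_sign e * real e * multinomial_sum (n - pent e) (m - e))"
    by (rule Omega_sum_columns_cong) (use Omega_difference_sums(2)[OF _ order.refl, of _ n m] in \<open>simp flip: of_nat_sum of_nat_mult of_nat_Suc of_nat_add\<close>)
  finally show ?thesis by simp
qed

text \<open>With weight \<open>pent e\<close> the column sum is \<open>n\<close>, while the division
  by \<open>m\<close> removes the numerator of \<open>b_coeff\<close>.\<close>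

lemma b_coeff_div_multinomial_sum:
  "real n * (b_coeff n m / real m) =
    - (\<Sum>e | 2 \<le> e \<and> e \<le> m \<and> pent e \<le> n. theta_sign e * pent e * multinomial_sum (n - pent e) (m - e))"
proof (cases "m = 0")
  case False
  have "real n * (b_coeff n m / real m) = (\<Sum>p\<in>Omega n m. (-1) ^ (m + p 2) / real (p 1 + p 2) *
      multinomial (p 1 + p 2) {j\<in>{1..n}. \<not> 3 dvd j} (difference p) * real n)"
    using False unfolding b_coeff_def difference_def[abs_def] sum_divide_distrib sum_distrib_left
    by (intro sum.cong) simp_all
  also have "\<dots> = - (\<Sum>e | 2 \<le> e \<and> e \<le> m \<and> pent e \<le> n. theta_sign e * real (pent e) * multinomial_sum (n - pent e) (m - e))"
    by (rule Omega_sum_columns_cong) (use Omega_difference_sums(3)[OF _ order.refl, of _ n m] in \<open>simp flip: of_nat_sum of_nat_mult\<close>)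
  finally show ?thesis by simp
\<comment> \<open>For \<open>m = 0\<close> the left side is 0 by division by zero and the index set
  on the right is empty.\<close>
qed (auto intro!: sum.neutral)

section \<open>Integrality and support of the coefficients\<close>

lemma pent_pos: "2 \<le> e \<Longrightarrow> 0 < pent e"
proof -
  assume "2 \<le> e"
  then have "2 * 3 \<le> e * (e + 1)" by (intro mult_le_mono) auto
  then show ?thesis by (simp add: pent_def div_greater_zero_iff)
qed

lemma theta_sign_Ints: "theta_sign e \<in> \<int>"
  by (simp add: theta_sign_def)

lemma multinomial_sum_Ints: "multinomial_sum n m \<in> \<int>"
proof (induction n arbitrary: m rule: less_induct)
  case (less n)
  show ?case
  proof (cases "n = 0")
    case False
    have "n - pent e < n" if "2 \<le> e" for e
      using pent_pos[OF that] False by simp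
    then show ?thesis
      unfolding multinomial_sum_rec[OF False[unfolded neq0_conv]]
      by (auto intro!: Ints_minus Ints_sum Ints_mult theta_sign_Ints less.IH)
  qed (simp add: multinomial_sum_0)
qed

text \<open>Some term of the recursion is nonzero, and both bounds survive adding its column: e(e+1)
  + m'(m'+1) is at most (e+m')(e+m'+1), and \<open>e \<le> 2 * pent e\<close>.\<close>

lemma multinomial_sum_nonzero:
  assumes "multinomial_sum n m \<noteq> 0"
  shows "6 * n \<le> m * (m + 1) \<and> m \<le> 2 * n"
  using assms
proof (induction n arbitrary: m rule: less_induct)
  case (less n)
  show ?case
  proof (cases "n = 0")
    case True
    then show ?thesis using less.prems by (simp add: multinomial_sum_0 split: if_splits)
  next
    case False
    then obtain e where e: "2 \<le> e" "e \<le> m" "pent e \<le> n" "theta_sign e \<noteq> 0"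
      "multinomial_sum (n - pent e) (m - e) \<noteq> 0"
      using less.prems multinomial_sum_rec[of n m] by (fastforce elim!: sum.not_neutral_contains_not_neutral)
    define n' m' where "n' = n - pent e" and "m' = m - e"
    have nm: "n = n' + pent e" "m = m' + e" using e by (simp_all add: n'_def m'_def)
    have "n' < n" using pent_pos[OF e(1)] nm by simp
    then have "6 * n' \<le> m' * (m' + 1)" "m' \<le> 2 * n'"
      using less.IH[of n' m'] e(5) by (simp_all add: n'_def m'_def)
    then show ?thesis
      unfolding nm using six_pent[OF e(4)] le_two_pent[OF e(4)] by (simp add: algebra_simps)
  qed
qed

text \<open>The fraction \<open>m / (p 1 + p 2)\<close> has disappeared from the recursion, whose
  ingredients are all integral.\<close>

lemma b_coeff_Ints: "b_coeff n m \<in> \<int>"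
  unfolding b_coeff_multinomial_sum
  by (auto intro!: Ints_minus Ints_sum Ints_mult theta_sign_Ints multinomial_sum_Ints)

lemma b_coeff_nonzero:
  assumes "b_coeff n m \<noteq> 0"
  shows "6 * n \<le> m * (m + 1) \<and> m \<le> 2 * n"
proof -
  obtain e where e: "2 \<le> e" "e \<le> m" "pent e \<le> n" "theta_sign e \<noteq> 0"
      "multinomial_sum (n - pent e) (m - e) \<noteq> 0"
    using assms b_coeff_multinomial_sum[of n m] by (fastforce elim!: sum.not_neutral_contains_not_neutral)
  define n' m' where "n' = n - pent e" and "m' = m - e"
  have nm: "n = n' + pent e" "m = m' + e" using e by (simp_all add: n'_def m'_def)
  have "6 * n' \<le> m' * (m' + 1)" "m' \<le> 2 * n'"
    using multinomial_sum_nonzero[OF e(5)] by (simp_all add: n'_def m'_def)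
  then show ?thesis
    unfolding nm using six_pent[OF e(4)] le_two_pent[OF e(4)] by (simp add: algebra_simps)
qed

text \<open>Completing the square turns \<open>6 * n \<le> m * (m + 1)\<close> into 24n + 1 \<le>
  (2m + 1)^2.\<close>

lemma b_coeff_eq_0:
  assumes "int m < \<lfloor>(sqrt (24 * real n + 1) - 1) / 2\<rfloor>"
  shows "b_coeff n m = 0"
proof (rule ccontr)
  assume "b_coeff n m \<noteq> 0"
  then have "6 * n \<le> m * (m + 1)" using b_coeff_nonzero by blast
  then have "real (6 * n) \<le> real (m * (m + 1))" by (simp only: of_nat_le_iff)
  then have "24 * real n + 1 \<le> (2 * real m + 1)\<^sup>2"
    by (simp add: power2_eq_square algebra_simps)
  then have "sqrt (24 * real n + 1) \<le> 2 * real m + 1"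
    by (intro real_le_lsqrt) auto
  then show False using assms by (simp add: less_floor_iff)
qed

section \<open>Generating functions\<close>

text \<open>The bound excludes \<open>e = 1\<close>, where \<open>pent 1 = pent 0 = 0\<close> but the sign vanishes.\<close>

definition pent_fibre :: "nat \<Rightarrow> nat set" where
  "pent_fibre n = {e. e \<le> 2 * n \<and> pent e = n}"

lemma finite_pent_fibre: "finite (pent_fibre n)"
  unfolding pent_fibre_def by simp

lemma theta_convolution:
  fixes A :: "nat \<Rightarrow> nat \<Rightarrow> real" and f g :: "nat \<Rightarrow> real"
  assumes A: "\<And>n m. A n m =
      - (\<Sum>e | 2 \<le> e \<and> e \<le> m \<and> pent e \<le> n. theta_sign e * f e * multinomial_sum (n - pent e) (m - e))"
    and f0: "f 0 = 0" and supp: "\<And>n m. m > 2 * n \<Longrightarrow> A n m = 0"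
  shows "(\<Sum>i\<le>n. \<Sum>e\<in>pent_fibre i. theta_sign e * (\<Sum>m\<le>2 * (n - i). A (n - i) m * g (m + e))) =
    - (\<Sum>e\<in>pent_fibre n. theta_sign e * f e * g e)"
proof -
  \<comment> \<open>With \<open>S\<close> the series of \<open>multinomial_sum\<close>, the recurrences say \<open>Th 1 * S = 1\<close> and
    \<open>A' = - Th f * S\<close>, so \<open>Th 1 * A' = - Th f\<close>; then weight the coefficient of \<open>\<zeta>\<^sup>m\<close> by \<open>g m\<close>.\<close>
  define Th :: "(nat \<Rightarrow> real) \<Rightarrow> real fps fps"
    where "Th h = Abs_fps (\<lambda>n. Abs_fps (\<lambda>e. if pent e = n then theta_sign e * h e else 0))" for h
  define S :: "real fps fps" where "S = Abs_fps (\<lambda>n. Abs_fps (multinomial_sum n))"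
  define A' :: "real fps fps" where "A' = Abs_fps (\<lambda>n. Abs_fps (A n))"
  have Th_mult: "fps_nth (fps_nth (Th h * X) n) m =
      (\<Sum>e | e \<le> m \<and> pent e \<le> n. theta_sign e * h e * fps_nth (fps_nth X (n - pent e)) (m - e))" for h X n m
  proof -
    have "fps_nth (fps_nth (Th h * X) n) m = (\<Sum>i\<le>n. \<Sum>e\<le>m.
        if pent e = i then theta_sign e * h e * fps_nth (fps_nth X (n - i)) (m - e) else 0)"
      unfolding fps_mult_nth fps_sum_nth Th_def atLeast0AtMost
      by (intro sum.cong refl) auto
    also have "\<dots> = (\<Sum>e\<le>m. \<Sum>i\<le>n.
        if pent e = i then theta_sign e * h e * fps_nth (fps_nth X (n - i)) (m - e) else 0)"
      by (rule sum.swap)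
    also have "\<dots> = (\<Sum>e\<le>m. if pent e \<le> n then theta_sign e * h e * fps_nth (fps_nth X (n - pent e)) (m - e) else 0)"
      by (intro sum.cong refl) simp
    also have "\<dots> = (\<Sum>e | e \<le> m \<and> pent e \<le> n. theta_sign e * h e * fps_nth (fps_nth X (n - pent e)) (m - e))"
      unfolding sum.inter_filter[OF finite_atMost, symmetric] by (simp add: Collect_conj_eq)
    finally show ?thesis .
  qed
  have low: "{e. e \<le> m \<and> pent e \<le> n} - {0,1} = {e. 2 \<le> e \<and> e \<le> m \<and> pent e \<le> n}" for m n
    by auto
  have th: "theta_sign 0 = 1" "theta_sign 1 = 0" "pent 0 = 0" by (auto simp: theta_sign_def pent_def)
  have th2: "2 \<le> e" if "theta_sign e \<noteq> 0" "e > 0" for e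
    using that th(2) by (cases "e = 1") auto
  have split: "(\<Sum>e | e \<le> m \<and> pent e \<le> n. theta_sign e * X e) =
      X 0 + (\<Sum>e | 2 \<le> e \<and> e \<le> m \<and> pent e \<le> n. theta_sign e * X e)" for m n and X :: "nat \<Rightarrow> real"
  proof -
    have "(\<Sum>e | e \<le> m \<and> pent e \<le> n. theta_sign e * X e) =
       (\<Sum>e\<in>insert 0 {e. 2 \<le> e \<and> e \<le> m \<and> pent e \<le> n}. theta_sign e * X e)"
      using th by (intro sum.mono_neutral_right) (auto intro: th2)
    then show ?thesis using th by (simp add: sum.insert)
  qed
  have Th_S: "Th (\<lambda>_. 1) * S = 1"
  proof (intro fps_ext)
    fix n m
    have "fps_nth (fps_nth (Th (\<lambda>_. 1) * S) n) m = multinomial_sum n m +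
        (\<Sum>e | 2 \<le> e \<and> e \<le> m \<and> pent e \<le> n. theta_sign e * multinomial_sum (n - pent e) (m - e))"
      using split[where m = m and n = n and X = "\<lambda>e. multinomial_sum (n - pent e) (m - e)"] th
      by (simp add: Th_mult S_def)
    also have "\<dots> = fps_nth (fps_nth 1 n) m"
    proof (cases "n = 0")
      case True
      then have "{e. 2 \<le> e \<and> e \<le> m \<and> pent e \<le> n} = {}" using pent_pos by fastforce
      then show ?thesis using True by (simp only: sum.empty) (simp add: multinomial_sum_0)
    next
      case False
      then show ?thesis using multinomial_sum_rec[of n m] by simp
    qed
    finally show "fps_nth (fps_nth (Th (\<lambda>_. 1) * S) n) m = fps_nth (fps_nth 1 n) m" .
  qed
  have A_S: "A' = - (Th f * S)"
  proof (intro fps_ext)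
    fix n m
    show "fps_nth (fps_nth A' n) m = fps_nth (fps_nth (- (Th f * S)) n) m"
      using split[where m = m and n = n and X = "\<lambda>e. f e * multinomial_sum (n - pent e) (m - e)"] A[of n m] f0
      by (simp add: Th_mult S_def A'_def mult.assoc)
  qed
  have "Th (\<lambda>_. 1) * A' = - Th f * (Th (\<lambda>_. 1) * S)"
    unfolding A_S by (simp add: algebra_simps)
  then have *: "Th (\<lambda>_. 1) * A' = - Th f" unfolding Th_S by simp
  have coeff: "(\<Sum>e | e \<le> m \<and> pent e \<le> n. theta_sign e * A (n - pent e) (m - e)) =
      - (if pent m = n then theta_sign m * f m else 0)" for m
    using arg_cong[OF *, of "\<lambda>F. fps_nth (fps_nth F n) m"] Th_mult[where h = "\<lambda>_. 1" and X = A' and n = n and m = m]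
    by (simp add: A'_def Th_def)
  have "- (\<Sum>e\<in>pent_fibre n. theta_sign e * f e * g e) =
      (\<Sum>m\<le>2 * n. - (if pent m = n then theta_sign m * f m else 0) * g m)"
  proof -
    have "(\<Sum>e\<in>pent_fibre n. theta_sign e * f e * g e) =
        (\<Sum>e\<in>{e\<in>{..2*n}. pent e = n}. theta_sign e * f e * g e)"
      by (simp add: pent_fibre_def)
    also have "\<dots> = (\<Sum>e\<le>2*n. if pent e = n then theta_sign e * f e * g e else 0)"
      by (rule sum.inter_filter) simp
    finally show ?thesis by (simp only: sum_negf[symmetric]) (rule sum.cong; simp)
  qed
  also have "\<dots> = (\<Sum>m\<le>2 * n. (\<Sum>e | e \<le> m \<and> pent e \<le> n. theta_sign e * A (n - pent e) (m - e)) * g m)"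
    unfolding coeff ..
  \<comment> \<open>Writing \<open>g m\<close> as \<open>g (m - e + e)\<close> prepares the
    substitution of \<open>m + e\<close> for \<open>m\<close> after the interchange of sums.\<close>
  also have "\<dots> = (\<Sum>m\<le>2 * n. \<Sum>e\<le>m. if pent e \<le> n then theta_sign e * A (n - pent e) (m - e) * g (m - e + e) else 0)"
  proof (intro sum.cong refl)
    fix m
    have "(\<Sum>e | e \<le> m \<and> pent e \<le> n. theta_sign e * A (n - pent e) (m - e)) =
        (\<Sum>e\<in>{e\<in>{..m}. pent e \<le> n}. theta_sign e * A (n - pent e) (m - e))"
      by simp
    also have "\<dots> = (\<Sum>e\<le>m. if pent e \<le> n then theta_sign e * A (n - pent e) (m - e) else 0)"
      by (rule sum.inter_filter) simp
    finally show "(\<Sum>e | e \<le> m \<and> pent e \<le> n. theta_sign e * A (n - pent e) (m - e)) * g m =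
        (\<Sum>e\<le>m. if pent e \<le> n then theta_sign e * A (n - pent e) (m - e) * g (m - e + e) else 0)"
      by (simp add: sum_distrib_right) (rule sum.cong; simp)
  qed
  also have "\<dots> = (\<Sum>e\<le>2 * n. \<Sum>m\<le>2 * n - e. if pent e \<le> n then theta_sign e * A (n - pent e) m * g (m + e) else 0)"
    unfolding sum.Sigma[OF finite_atMost ballI[OF finite_atMost]]
    by (rule sum.reindex_bij_witness[of _ "\<lambda>(e, m). (m + e, e)" "\<lambda>(m, e). (e, m - e)"]) auto
  also have "\<dots> = (\<Sum>e\<in>{e\<in>{..2*n}. pent e \<le> n}. theta_sign e * (\<Sum>m\<le>2 * (n - pent e). A (n - pent e) m * g (m + e)))"
    unfolding sum.inter_filter[OF finite_atMost]
  proof (intro sum.cong refl)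
    fix e
    show "(\<Sum>m\<le>2 * n - e. if pent e \<le> n then theta_sign e * A (n - pent e) m * g (m + e) else 0) =
        (if pent e \<le> n then theta_sign e * (\<Sum>m\<le>2 * (n - pent e). A (n - pent e) m * g (m + e)) else 0)"
    proof (cases "pent e \<le> n \<and> theta_sign e \<noteq> 0")
      case True
      \<comment> \<open>By \<open>supp\<close> the inner range can be cut at a bound that depends on
        \<open>e\<close> only through \<open>pent e\<close>, so that the terms can be grouped by the
        value of \<open>pent e\<close>.\<close>
      then have "2 * (n - pent e) \<le> 2 * n - e" using le_two_pent[of e] by linarith
      then have "(\<Sum>m\<le>2 * n - e. A (n - pent e) m * g (m + e)) =
          (\<Sum>m\<le>2 * (n - pent e). A (n - pent e) m * g (m + e))"
        by (intro sum.mono_neutral_right) (auto intro: supp)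
      then show ?thesis using True by (simp add: sum_distrib_left[symmetric] mult.assoc)
    qed auto
  qed
  also have "\<dots> = (\<Sum>i\<le>n. \<Sum>e\<in>{e \<in> {e\<in>{..2*n}. pent e \<le> n}. pent e = i}. theta_sign e * (\<Sum>m\<le>2 * (n - pent e). A (n - pent e) m * g (m + e)))"
    by (intro sum.group[symmetric]) auto
  also have "\<dots> = (\<Sum>i\<le>n. \<Sum>e\<in>pent_fibre i. theta_sign e * (\<Sum>m\<le>2 * (n - i). A (n - i) m * g (m + e)))"
  proof (rule sum.cong[OF refl])
    fix i assume "i \<in> {..n}"
    \<comment> \<open>Indices of the group outside \<open>pent_fibre i\<close> exceed
      \<open>2 * i\<close> and have sign 0.\<close>
    then have "(\<Sum>e\<in>{e \<in> {e\<in>{..2*n}. pent e \<le> n}. pent e = i}. theta_sign e * X e) =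
        (\<Sum>e\<in>pent_fibre i. theta_sign e * X e)" for X
      by (intro sum.mono_neutral_right) (auto simp: pent_fibre_def dest: le_two_pent)
    then show "(\<Sum>e\<in>{e \<in> {e\<in>{..2*n}. pent e \<le> n}. pent e = i}. theta_sign e *
          (\<Sum>m\<le>2 * (n - pent e). A (n - pent e) m * g (m + e))) =
        (\<Sum>e\<in>pent_fibre i. theta_sign e * (\<Sum>m\<le>2 * (n - i). A (n - i) m * g (m + e)))"
      by (simp add: pent_fibre_def)
  qed
  finally show ?thesis ..
qed

text \<open>The k-th derivative of \<Phi>(exp w; q) in w at 0, as a power series in q.\<close>

definition theta_fps :: "nat \<Rightarrow> complex fps" where
  "theta_fps k = Abs_fps (\<lambda>n. of_real (\<Sum>e\<in>pent_fibre n. theta_sign e * real e ^ k))"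

text \<open>The index is shifted: \<open>b_fps k\<close> will be the series of the false Eisenstein
  series with index \<open>k + 1\<close>, up to the constant -1/2 for \<open>k = 0\<close>.\<close>

definition b_fps :: "nat \<Rightarrow> complex fps" where
  "b_fps k = Abs_fps (\<lambda>n. of_real (\<Sum>m\<le>2 * n. b_coeff n m * real m ^ k))"

text \<open>To become minus the logarithm of the Euler product; the term \<open>m = 0\<close> is 0
  by division by zero.\<close>

definition log_fps :: "complex fps" where
  "log_fps = Abs_fps (\<lambda>n. of_real (\<Sum>m\<le>2 * n. b_coeff n m / real m))"

lemma b_coeff_eq_0_large: "m > 2 * n \<Longrightarrow> b_coeff n m = 0"
  using b_coeff_nonzero[of n m] by (cases "b_coeff n m = 0") auto

text \<open>The Leibniz rule at w = 0 for \<Phi> times its negative logarithmic derivative. It comes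
  from \<open>theta_convolution\<close> with weight \<open>e\<close> and g(m) = m^k, the binomial
  theorem separating the moments in (m + e)^k.\<close>

lemma b_fps_rec:
  "(\<Sum>j\<le>k. of_nat (k choose j) * (theta_fps (k - j) * b_fps j)) = - theta_fps (Suc k)"
proof (rule fps_ext)
  fix n
  have "fps_nth (\<Sum>j\<le>k. of_nat (k choose j) * (theta_fps (k - j) * b_fps j)) n =
      of_real (\<Sum>j\<le>k. of_nat (k choose j) * (\<Sum>i\<le>n. (\<Sum>e\<in>pent_fibre i. theta_sign e * real e ^ (k - j)) *
        (\<Sum>m\<le>2 * (n - i). b_coeff (n - i) m * real m ^ j)))"
    unfolding fps_sum_nth fps_mult_of_nat_nth
    by (simp add: fps_mult_nth theta_fps_def b_fps_def atLeast0AtMost)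
  also have "(\<Sum>j\<le>k. of_nat (k choose j) * (\<Sum>i\<le>n. (\<Sum>e\<in>pent_fibre i. theta_sign e * real e ^ (k - j)) *
        (\<Sum>m\<le>2 * (n - i). b_coeff (n - i) m * real m ^ j))) =
      (\<Sum>i\<le>n. \<Sum>j\<le>k. \<Sum>m\<le>2 * (n - i). \<Sum>e\<in>pent_fibre i.
        theta_sign e * (b_coeff (n - i) m * (of_nat (k choose j) * real m ^ j * real e ^ (k - j))))"
    unfolding sum_distrib_left sum_distrib_right
    by (rule trans[OF sum.swap]) (simp add: mult_ac)
  also have "\<dots> = (\<Sum>i\<le>n. \<Sum>e\<in>pent_fibre i. theta_sign e * (\<Sum>m\<le>2 * (n - i). b_coeff (n - i) m * real (m + e) ^ k))"
  proof (rule sum.cong[OF refl])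
    fix i
    have "(\<Sum>j\<le>k. \<Sum>m\<le>2 * (n - i). \<Sum>e\<in>pent_fibre i.
        theta_sign e * (b_coeff (n - i) m * (of_nat (k choose j) * real m ^ j * real e ^ (k - j)))) =
        (\<Sum>e\<in>pent_fibre i. \<Sum>m\<le>2 * (n - i). \<Sum>j\<le>k.
        theta_sign e * (b_coeff (n - i) m * (of_nat (k choose j) * real m ^ j * real e ^ (k - j))))"
      by (rule trans[OF sum.swap], rule trans[OF sum.cong[OF refl sum.swap]], rule sum.swap)
    also have "\<dots> = (\<Sum>e\<in>pent_fibre i. theta_sign e * (\<Sum>m\<le>2 * (n - i). b_coeff (n - i) m * real (m + e) ^ k))"
      unfolding of_nat_add binomial_ring sum_distrib_left ..
    finally show "(\<Sum>j\<le>k. \<Sum>m\<le>2 * (n - i). \<Sum>e\<in>pent_fibre i.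
        theta_sign e * (b_coeff (n - i) m * (of_nat (k choose j) * real m ^ j * real e ^ (k - j)))) =
        (\<Sum>e\<in>pent_fibre i. theta_sign e * (\<Sum>m\<le>2 * (n - i). b_coeff (n - i) m * real (m + e) ^ k))" .
  qed
  also have "\<dots> = - (\<Sum>e\<in>pent_fibre n. theta_sign e * real e * real e ^ k)"
    by (rule theta_convolution[where A = b_coeff and f = real and g = "\<lambda>m. real m ^ k"])
      (rule b_coeff_multinomial_sum, simp_all add: b_coeff_eq_0_large)
  finally show "fps_nth (\<Sum>j\<le>k. of_nat (k choose j) * (theta_fps (k - j) * b_fps j)) n =
      fps_nth (- theta_fps (Suc k)) n"
    by (simp add: theta_fps_def mult.assoc)
qed

text \<open>From \<open>theta_convolution\<close> with \<open>g = 1\<close> and the weight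
  \<open>pent e\<close>, which is constantly n on the fibre of n. The factor \<open>fps_X\<close>
  makes the derivative act as multiplication of the n-th coefficient by n and is cancelled at the
  end.\<close>

lemma log_fps_deriv: "theta_fps 0 * fps_deriv log_fps = - fps_deriv (theta_fps 0)"
proof -
  have "fps_X * (theta_fps 0 * fps_deriv log_fps) = fps_X * - fps_deriv (theta_fps 0)"
  proof (rule fps_ext)
    fix n
    have X: "fps_nth (fps_X * fps_deriv F) i = of_nat i * fps_nth F i" for F :: "complex fps" and i
      by (cases i) simp_all
    have "fps_nth (theta_fps 0 * (fps_X * fps_deriv log_fps)) n =
      of_real (\<Sum>i\<le>n. (\<Sum>e\<in>pent_fibre i. theta_sign e) *
        (real (n - i) * (\<Sum>m\<le>2 * (n - i). b_coeff (n - i) m / real m)))"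
      unfolding fps_mult_nth[of "theta_fps 0"] X
      by (simp add: theta_fps_def log_fps_def atLeast0AtMost)
    also have "(\<Sum>i\<le>n. (\<Sum>e\<in>pent_fibre i. theta_sign e) *
        (real (n - i) * (\<Sum>m\<le>2 * (n - i). b_coeff (n - i) m / real m))) =
      (\<Sum>i\<le>n. \<Sum>e\<in>pent_fibre i. theta_sign e *
        (\<Sum>m\<le>2 * (n - i). (real (n - i) * (b_coeff (n - i) m / real m)) * 1))"
      by (simp only: sum_distrib_left[symmetric] sum_distrib_right[symmetric] mult_1_right)
    also have "(\<Sum>i\<le>n. \<Sum>e\<in>pent_fibre i. theta_sign e *
        (\<Sum>m\<le>2 * (n - i). (real (n - i) * (b_coeff (n - i) m / real m)) * 1)) =
      - (\<Sum>e\<in>pent_fibre n. theta_sign e * real (pent e) * 1)"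
      by (rule theta_convolution[where A = "\<lambda>n m. real n * (b_coeff n m / real m)" and
            f = "\<lambda>e. real (pent e)" and g = "\<lambda>_. 1"])
        (rule b_coeff_div_multinomial_sum, simp_all add: pent_def b_coeff_eq_0_large)
    also have "(\<Sum>e\<in>pent_fibre n. theta_sign e * real (pent e) * 1) = n * (\<Sum>e\<in>pent_fibre n. theta_sign e)"
      unfolding sum_distrib_left by (intro sum.cong refl) (auto simp: pent_fibre_def)
    finally show "fps_nth (fps_X * (theta_fps 0 * fps_deriv log_fps)) n =
        fps_nth (fps_X * - fps_deriv (theta_fps 0)) n"
      using X[of "theta_fps 0" n] by (simp add: theta_fps_def mult.left_commute)
  qed
  then show ?thesis
    by (simp only: mult_cancel_left fps_X_neq_zero simp_thms)
qed

section \<open>Convergence of the theta series and its expansions in q and in w\<close>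

lemma summable_exp_pent:
  fixes r x :: real
  assumes "0 \<le> r" "r < 1"
  shows "summable (\<lambda>e. exp (x * real e) * r ^ pent e)"
proof -
  have "(\<lambda>N. exp x * r ^ N) \<longlonglongrightarrow> exp x * 0"
    using assms by (intro tendsto_intros LIMSEQ_power_zero) auto
  then have "\<forall>\<^sub>F N in sequentially. exp x * r ^ N < 1/2"
    by (rule order_tendstoD) simp
  then obtain N where N: "exp x * r ^ N < 1/2" by (meson eventually_sequentially order.refl)
  show ?thesis
  proof (rule summable_comparison_test)
    show "summable (\<lambda>e. (1/2::real) ^ e)" by (intro summable_geometric) simp
    show "\<exists>M. \<forall>e\<ge>M. norm (exp (x * real e) * r ^ pent e) \<le> (1/2) ^ e"
    proof (intro exI allI impI)
      \<comment> \<open>From \<open>6 * N\<close> on, e(e+1)/6 is at least N e, so the quadratic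
        exponent beats the exponential factor: the term is at most the e-th power of
        \<open>exp x * r ^ N\<close>, which is below 1/2.\<close>
      fix e assume e: "e \<ge> 6 * N"
      have "(N * e) * 6 \<le> e * (e + 1)" using e by (simp add: algebra_simps) (metis mult.left_commute mult_le_mono2 trans_le_add2)
      then have "N * e \<le> pent e" unfolding pent_def by (simp add: less_eq_div_iff_mult_less_eq)
      then have "r ^ pent e \<le> r ^ (N * e)" using assms by (intro power_decreasing) auto
      then have "exp (x * real e) * r ^ pent e \<le> exp (x * real e) * r ^ (N * e)" by simp
      also have "\<dots> = (exp x * r ^ N) ^ e"
        by (simp add: power_mult_distrib power_mult exp_of_nat2_mult)
      also have "\<dots> \<le> (1/2) ^ e" using N assms by (intro power_mono) auto
      finally show "norm (exp (x * real e) * r ^ pent e) \<le> (1/2) ^ e" using assms by simp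
    qed
  qed
qed

definition theta_moment :: "nat \<Rightarrow> complex \<Rightarrow> complex" where
  "theta_moment k q = (\<Sum>e. of_real (theta_sign e * real e ^ k) * q ^ pent e)"

lemma abs_theta_sign_le: "\<bar>theta_sign e\<bar> \<le> 1"
  by (simp add: theta_sign_def)

lemma summable_theta_moment:
  assumes "norm q < 1"
  shows "summable (\<lambda>e. norm (of_real (theta_sign e * real e ^ k) * q ^ pent e :: complex))"
proof (rule summable_comparison_test'[where N = 0])
  show "summable (\<lambda>e. exp (real k * real e) * norm q ^ pent e)"
    using assms by (intro summable_exp_pent) auto
  show "norm (norm (of_real (theta_sign e * real e ^ k) * q ^ pent e :: complex)) \<le>
      exp (real k * real e) * norm q ^ pent e" for e
  proof -
    have "real e ^ k \<le> exp (real e) ^ k"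
      by (intro power_mono) (use exp_ge_add_one_self[of "real e"] in linarith, simp)
    then have "\<bar>theta_sign e\<bar> * real e ^ k \<le> 1 * exp (real k * real e)"
      using abs_theta_sign_le by (intro mult_mono) (auto simp: exp_of_nat_mult)
    then show ?thesis
      by (simp add: norm_mult norm_power abs_mult mult_right_mono)
  qed
qed

text \<open>Absolute convergence permits regrouping the series over \<open>e\<close> by powers of q;
  discarding the zero signs first puts each group inside \<open>pent_fibre n\<close>.\<close>

lemma theta_fps_sums:
  assumes "norm q < 1"
  shows "(\<lambda>n. fps_nth (theta_fps k) n * q ^ n) sums theta_moment k q"
proof -
  define t where "t e = of_real (theta_sign e * real e ^ k) * q ^ pent e" for e
  define E where "E = {e. theta_sign e \<noteq> 0}"
  have "(t has_sum theta_moment k q) UNIV"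
    unfolding theta_moment_def t_def
    by (rule norm_summable_imp_has_sum[OF _ summable_sums[OF summable_norm_cancel]];
        rule summable_theta_moment[OF assms])
  moreover have "(t has_sum theta_moment k q) UNIV \<longleftrightarrow> (t has_sum theta_moment k q) E"
    by (rule has_sum_cong_neutral) (auto simp: t_def E_def)
  moreover have "(t has_sum theta_moment k q) E \<longleftrightarrow>
      ((\<lambda>(n, e). t e) has_sum theta_moment k q) (SIGMA n:UNIV. {e\<in>E. pent e = n})"
    by (rule has_sum_reindex_bij_witness[of _ snd "\<lambda>e. (pent e, e)"]) auto
  ultimately have "((\<lambda>(n, e). t e) has_sum theta_moment k q) (SIGMA n:UNIV. {e\<in>E. pent e = n})"
    by blast
  then have "((\<lambda>n. fps_nth (theta_fps k) n * q ^ n) has_sum theta_moment k q) UNIV"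
  proof (rule has_sum_SigmaD)
    fix n
    have sub: "{e\<in>E. pent e = n} \<subseteq> pent_fibre n"
      using le_two_pent by (auto simp: E_def pent_fibre_def)
    have "(\<Sum>e\<in>{e\<in>E. pent e = n}. t e) = (\<Sum>e\<in>pent_fibre n. t e)"
      using sub by (intro sum.mono_neutral_left finite_pent_fibre) (auto simp: E_def t_def pent_fibre_def)
    also have "\<dots> = fps_nth (theta_fps k) n * q ^ n"
      by (auto simp: theta_fps_def t_def sum_distrib_right pent_fibre_def intro!: sum.cong)
    finally show "((\<lambda>e. case (n, e) of (n, e) \<Rightarrow> t e) has_sum fps_nth (theta_fps k) n * q ^ n) {e\<in>E. pent e = n}"
      using finite_subset[OF sub finite_pent_fibre] by (simp add: has_sum_finiteI)
  qed
  then show ?thesis by (rule has_sum_imp_sums)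
qed

lemma theta_fps_conv_radius: "fps_conv_radius (theta_fps k) \<ge> 1"
  unfolding fps_conv_radius_def
proof (rule conv_radius_geI_ex)
  fix r :: real assume "0 < r" "ereal r < 1"
  then have "norm (of_real r :: complex) < 1" by simp
  from theta_fps_sums[OF this, of k] \<open>0 < r\<close>
  show "\<exists>z. norm z = r \<and> summable (\<lambda>n. fps_nth (theta_fps k) n * z ^ n)"
    by (intro exI[of _ "of_real r"]) (auto simp: sums_iff)
qed

lemma eval_theta_fps: "norm q < 1 \<Longrightarrow> eval_fps (theta_fps k) q = theta_moment k q"
  using theta_fps_sums[of q k] by (simp add: eval_fps_def sums_iff)

text \<open>This is \<Phi> in the variable w with \<zeta> = exp w.\<close>

definition partial_theta :: "complex \<Rightarrow> complex \<Rightarrow> complex" where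
  "partial_theta q w = (\<Sum>e. of_real (theta_sign e) * exp w ^ e * q ^ pent e)"

lemma summable_partial_theta:
  fixes q w :: complex
  assumes "norm q < 1"
  shows "summable (\<lambda>e. norm (of_real (theta_sign e) * exp w ^ e * q ^ pent e))"
proof (rule summable_comparison_test'[where N = 0])
  show "summable (\<lambda>e. exp (Re w * real e) * norm q ^ pent e)"
    using assms by (intro summable_exp_pent) auto
  show "norm (norm (of_real (theta_sign e) * exp w ^ e * q ^ pent e)) \<le>
      exp (Re w * real e) * norm q ^ pent e" for e
    using abs_theta_sign_le[of e]
    by (simp add: norm_mult norm_power mult.assoc mult_left_le_one_le exp_of_nat2_mult)
qed

text \<open>Three consecutive indices form one term: 3n gives its leading part, 3n+1 has sign 0, and
  3n+2 gives the part with the extra factor -\<zeta>^2 q^(2n+1).\<close>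

lemma partial_theta_sums:
  assumes "norm q < 1"
  shows "(\<lambda>n. (-1) ^ n * exp w ^ (3*n) * q ^ (n * (3*n+1) div 2) * (1 - exp w^2 * q ^ (2*n+1)))
    sums partial_theta q w"
proof -
  define t where "t e = of_real (theta_sign e) * exp w ^ e * q ^ pent e" for e
  have "t sums partial_theta q w"
    unfolding t_def partial_theta_def
    by (rule summable_sums[OF summable_norm_cancel[OF summable_partial_theta[OF assms]]])
  then have "(\<lambda>n. sum t {n * 3..<n * 3 + 3}) sums partial_theta q w"
    by (rule sums_group) simp
  moreover have "sum t {n * 3..<n * 3 + 3} =
      (-1) ^ n * exp w ^ (3*n) * q ^ (n * (3*n+1) div 2) * (1 - exp w^2 * q ^ (2*n+1))" for n
  proof -
    have "{n * 3..<n * 3 + 3} = {3 * n, 3 * n + 1, 3 * n + 2}" by auto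
    then have "sum t {n * 3..<n * 3 + 3} = t (3 * n) + t (3 * n + 1) + t (3 * n + 2)"
      by simp
    also have "t (3 * n + 1) = 0"
    proof -
      have "(3 * n + 1) mod 3 = 1" by presburger
      then show ?thesis by (simp add: t_def theta_sign_def)
    qed
    also have "t (3 * n) = (-1) ^ n * exp w ^ (3*n) * q ^ (n * (3*n+1) div 2)"
    proof -
      have "pent (3 * n) = (3 * (n * (3*n+1))) div (3 * 2)" by (simp add: pent_def algebra_simps)
      also have "\<dots> = n * (3*n+1) div 2" by (rule div_mult_mult1) simp
      finally show ?thesis by (simp add: t_def theta_sign_def)
    qed
    also have "t (3 * n + 2) = - ((-1) ^ n * exp w ^ (3*n + 2) * q ^ (n * (3*n+1) div 2 + (2*n+1)))"
    proof -
      have "pent (3 * n + 2) = (3 * (n * (3*n+1) + (2*n+1) * 2)) div (3 * 2)" by (simp add: pent_def algebra_simps)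
      also have "\<dots> = (n * (3*n+1) + (2*n+1) * 2) div 2" by (rule div_mult_mult1) simp
      also have "\<dots> = n * (3*n+1) div 2 + (2*n+1)" by (subst div_mult_self1) simp_all
      finally have p: "pent (3 * n + 2) = n * (3*n+1) div 2 + (2*n+1)" .
      have "(3 * n + 2) mod 3 = 2" "(3 * n + 2) div 3 = n" by presburger+
      then show ?thesis unfolding t_def p by (simp add: theta_sign_def)
    qed
    finally show ?thesis by (simp add: algebra_simps power_add power2_eq_square)
  qed
  ultimately show ?thesis by simp
qed

lemma false_theta_exp:
  assumes "norm q < 1"
  shows "false_theta (exp w) q = (1 - exp w) * partial_theta q w"
  using partial_theta_sums[OF assms, of w] by (simp add: false_theta_def sums_iff)

text \<open>Expand each exp(e w) and interchange the sums. The double series converges absolutely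
  because replacing its terms by their norms amounts to replacing w by |w|, which
  \<open>summable_exp_pent\<close> covers.\<close>

lemma partial_theta_has_fps_expansion:
  assumes "norm q < 1"
  shows "partial_theta q has_fps_expansion Abs_fps (\<lambda>k. theta_moment k q / fact k)"
proof (rule has_fps_expansionI, rule always_eventually, rule allI)
  fix w :: complex
  define a where "a = (\<lambda>(e, k). of_real (theta_sign e) * q ^ pent e * ((of_nat e * w) ^ k /\<^sub>R fact k))"
  have "((\<lambda>k. norm (a (e, k))) has_sum \<bar>theta_sign e\<bar> * norm q ^ pent e * exp (real e * norm w)) UNIV" for e
  proof -
    have "(\<lambda>k. (real e * norm w) ^ k /\<^sub>R fact k) sums exp (real e * norm w)" by (rule exp_converges)
    then have "((\<lambda>k. (real e * norm w) ^ k /\<^sub>R fact k) has_sum exp (real e * norm w)) UNIV"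
      by (intro norm_summable_imp_has_sum) (auto simp: sums_iff)
    from has_sum_cmult_right[OF this, of "\<bar>theta_sign e\<bar> * norm q ^ pent e"]
    show ?thesis by (simp add: a_def norm_mult norm_power norm_divide power_mult_distrib mult_ac)
  qed
  moreover have "(\<lambda>e. \<bar>theta_sign e\<bar> * norm q ^ pent e * exp (real e * norm w)) summable_on UNIV"
  proof (rule norm_summable_imp_summable_on, rule summable_comparison_test'[where N = 0])
    show "summable (\<lambda>e. exp (norm w * real e) * norm q ^ pent e)"
      using assms by (intro summable_exp_pent) auto
    show "norm (norm (\<bar>theta_sign e\<bar> * norm q ^ pent e * exp (real e * norm w))) \<le>
        exp (norm w * real e) * norm q ^ pent e" for e
      using abs_theta_sign_le[of e] by (simp add: abs_mult mult_left_le_one_le mult.assoc mult.commute)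
  qed
  ultimately have "(\<lambda>x. norm (a x)) summable_on (UNIV \<times> UNIV)"
    by (intro summable_on_SigmaI[where g = "\<lambda>e. \<bar>theta_sign e\<bar> * norm q ^ pent e * exp (real e * norm w)"]) auto
  then have "a summable_on (UNIV \<times> UNIV)" by (rule abs_summable_summable)
  then obtain S where S: "(a has_sum S) (UNIV \<times> UNIV)" by (auto simp: summable_on_def)
  have "((\<lambda>e. of_real (theta_sign e) * exp w ^ e * q ^ pent e) has_sum S) UNIV"
  proof (rule has_sum_SigmaD[OF S])
    fix e
    have "(\<lambda>k. (of_nat e * w) ^ k /\<^sub>R fact k) sums exp (of_nat e * w)" by (rule exp_converges)
    moreover have "summable (\<lambda>k. norm ((of_nat e * w) ^ k /\<^sub>R fact k))" by (rule summable_norm_exp)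
    ultimately have "((\<lambda>k. (of_nat e * w) ^ k /\<^sub>R fact k) has_sum exp (of_nat e * w)) UNIV"
      by (intro norm_summable_imp_has_sum)
    from has_sum_cmult_right[OF this, of "of_real (theta_sign e) * q ^ pent e"]
    show "((\<lambda>k. a (e, k)) has_sum of_real (theta_sign e) * exp w ^ e * q ^ pent e) UNIV"
      by (simp add: a_def exp_of_nat2_mult mult_ac)
  qed
  then have S_eq: "S = partial_theta q w"
    unfolding partial_theta_def using has_sum_imp_sums sums_unique by blast
  have "((\<lambda>k. theta_moment k q / fact k * w ^ k) has_sum S) UNIV"
  proof (rule has_sum_SigmaD[OF has_sum_swap[THEN iffD1, OF S]])
    fix k
    have "((\<lambda>e. of_real (theta_sign e * real e ^ k) * q ^ pent e) has_sum theta_moment k q) UNIV"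
      unfolding theta_moment_def
      by (rule norm_summable_imp_has_sum[OF _ summable_sums[OF summable_norm_cancel]];
          rule summable_theta_moment[OF assms])
    from has_sum_cmult_left[OF this, of "w ^ k / fact k"]
    show "((\<lambda>e. case (k, e) of (x, y) \<Rightarrow> a (y, x)) has_sum theta_moment k q / fact k * w ^ k) UNIV"
      by (simp add: a_def power_mult_distrib scaleR_conv_of_real field_simps)
  qed
  then show "(\<lambda>k. fps_nth (Abs_fps (\<lambda>k. theta_moment k q / fact k)) k * w ^ k) sums partial_theta q w"
    unfolding S_eq by (simp add: has_sum_imp_sums)
qed

section \<open>Euler's pentagonal number theorem\<close>

text \<open>The quotient (q)_n/(q)_s of q-factorial products, written without denominators.\<close>

definition gauss_factor :: "nat \<Rightarrow> nat \<Rightarrow> 'a::field \<Rightarrow> 'a" where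
  "gauss_factor n s q = (\<Prod>k\<in>{s<..n}. 1 - q ^ k)"

lemma gauss_factor_Suc: "s \<le> n \<Longrightarrow> gauss_factor (Suc n) s q = gauss_factor n s q * (1 - q ^ Suc n)"
proof -
  assume "s \<le> n"
  then have "{s<..Suc n} = insert (Suc n) {s<..n}" by auto
  then show ?thesis by (simp add: gauss_factor_def mult.commute)
qed

lemma gauss_factor_rec: "s < n \<Longrightarrow> gauss_factor n s q = (1 - q ^ Suc s) * gauss_factor n (Suc s) q"
proof -
  assume "s < n"
  then have "{s<..n} = insert (Suc s) {Suc s<..n}" by auto
  then show ?thesis by (simp add: gauss_factor_def)
qed

text \<open>
  Shanks' finite form of the pentagonal number theorem: only the term \<open>s = 0\<close> on the left
  survives as \<open>n\<close> tends to infinity.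
\<close>

lemma pentagonal_finite:
  fixes q :: "'a::field"
  shows "(\<Sum>s\<le>n. (-1) ^ s * gauss_factor n s q * q ^ (s * n + s * (s + 1) div 2)) =
    1 + (\<Sum>s\<in>{1..n}. (-1) ^ s * (q ^ (s * (3 * s - 1) div 2) + q ^ (s * (3 * s + 1) div 2)))"
proof (induction n)
  case 0
  then show ?case by (simp add: gauss_factor_def)
next
  case (Suc n)
  define t where "t s = s * (s + 1) div 2" for s :: nat
  have t_Suc: "t (Suc s) = t s + Suc s" for s
  proof -
    have "Suc s * (Suc s + 1) = s * (s + 1) + Suc s * 2" by simp
    then show ?thesis unfolding t_def by (simp only: div_mult_self1)
  qed
  \<comment> \<open>Passing from \<open>n\<close> to \<open>Suc n\<close> changes the term at
    \<open>s\<close> by \<open>u (s - 1) - u s\<close>. The sum of these changes telescopes to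
    \<open>- u n\<close>, which together with the new term at \<open>Suc n\<close> supplies the two
    new pentagonal powers.\<close>
  define u where "u s = (-1) ^ s * gauss_factor n s q * q ^ (Suc s * Suc n + t s)" for s
  have step: "(-1) ^ s * gauss_factor (Suc n) s q * q ^ (s * Suc n + t s) =
      (-1) ^ s * gauss_factor n s q * q ^ (s * n + t s) - u s +
      (if s = 0 then 0 else u (s - 1))" if s: "s \<le> n" for s
  proof (cases s)
    case 0
    then show ?thesis using s by (simp add: u_def gauss_factor_Suc t_def algebra_simps)
  next
    case (Suc r)
    then have r: "r < n" using s by simp
    show ?thesis
      unfolding Suc
      by (simp add: u_def gauss_factor_Suc[OF s[unfolded Suc]] gauss_factor_rec[OF r] t_Suc
          algebra_simps power_add)
  qed
  have "(\<Sum>s\<le>Suc n. (-1) ^ s * gauss_factor (Suc n) s q * q ^ (s * Suc n + t s)) =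
      (\<Sum>s\<le>n. (-1) ^ s * gauss_factor n s q * q ^ (s * n + t s) - u s + (if s = 0 then 0 else u (s - 1)))
      + (-1) ^ Suc n * q ^ (Suc n * Suc n + t (Suc n))"
    using step by (simp add: gauss_factor_def)
  also have "(\<Sum>s\<le>n. (-1) ^ s * gauss_factor n s q * q ^ (s * n + t s) - u s + (if s = 0 then 0 else u (s - 1))) =
      (\<Sum>s\<le>n. (-1) ^ s * gauss_factor n s q * q ^ (s * n + t s)) -
      ((\<Sum>s\<le>n. u s) - (\<Sum>s\<le>n. if s = 0 then 0 else u (s - 1)))"
    by (simp add: sum.distrib sum_subtractf)
  also have "(\<Sum>s\<le>n. u s) - (\<Sum>s\<le>n. if s = 0 then 0 else u (s - 1)) = u n"
  proof -
    have "(\<Sum>s\<le>N. u s) = (\<Sum>s\<le>N. if s = 0 then 0 else u (s - 1)) + u N" for N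
      by (induction N) simp_all
    then show ?thesis by simp
  qed
  also have "u n = - ((-1) ^ Suc n * q ^ (Suc n * (3 * Suc n - 1) div 2))"
  proof -
    have "Suc n * (3 * Suc n - 1) = n * (n + 1) + (Suc n * Suc n) * 2" by (simp add: algebra_simps)
    then have "Suc n * (3 * Suc n - 1) div 2 = Suc n * Suc n + t n"
      unfolding t_def by (simp only: div_mult_self1)
    then show ?thesis by (simp add: u_def gauss_factor_def)
  qed
  also have "Suc n * Suc n + t (Suc n) = Suc n * (3 * Suc n + 1) div 2"
  proof -
    have "Suc n * (3 * Suc n + 1) = Suc n * (Suc n + 1) + (Suc n * Suc n) * 2" by (simp add: algebra_simps)
    then show ?thesis unfolding t_def by (simp only: div_mult_self1)
  qed
  also have "(\<Sum>s\<le>n. (-1) ^ s * gauss_factor n s q * q ^ (s * n + t s)) =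
      1 + (\<Sum>s\<in>{1..n}. (-1) ^ s * (q ^ (s * (3 * s - 1) div 2) + q ^ (s * (3 * s + 1) div 2)))"
    using Suc.IH by (simp add: t_def)
  finally show ?case
    unfolding t_def by (simp add: algebra_simps)
qed

lemma
  fixes q :: complex
  assumes q: "norm q < 1"
  shows convergent_euler_product: "convergent_prod (\<lambda>n. 1 - q ^ Suc n)"
    and euler_product_nonzero: "(\<Prod>n. 1 - q ^ Suc n) \<noteq> 0"
proof -
  have "summable (\<lambda>n. norm (1 - q ^ Suc n - 1))"
    using q by (simp add: norm_mult norm_power summable_mult summable_geometric)
  then show "convergent_prod (\<lambda>n. 1 - q ^ Suc n)"
    by (intro abs_convergent_prod_imp_convergent_prod summable_imp_abs_convergent_prod)
  moreover have "1 - q ^ Suc n \<noteq> 0" for n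
  proof
    assume "1 - q ^ Suc n = 0"
    then have "q ^ Suc n = 1" by (simp only: right_minus_eq)
    then have "norm q ^ Suc n = 1" by (metis norm_power norm_one)
    moreover have "norm q ^ Suc n \<le> norm q ^ 1" using q by (intro power_decreasing) auto
    ultimately show False using q by simp
  qed
  ultimately show "(\<Prod>n. 1 - q ^ Suc n) \<noteq> 0" by (rule prodinf_nonzero)
qed

text \<open>By 1 + x \<le> exp x all Gauss factors are bounded by exp(1/(1-|q|)), uniformly in
  \<open>n\<close> and \<open>s\<close>. Each term with \<open>s \<ge> 1\<close> contains at least
  q^n, so these terms together are O(n |q|^n).\<close>

lemma pentagonal_finite_limit:
  fixes q :: complex
  assumes q: "norm q < 1"
  shows "(\<lambda>n. \<Sum>s\<le>n. (-1) ^ s * gauss_factor n s q * q ^ (s * n + s * (s + 1) div 2)) \<longlonglongrightarrow>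
    (\<Prod>n. 1 - q ^ Suc n)"
proof -
  define r where "r = norm q"
  have r: "0 \<le> r" "r < 1" using q by (simp_all add: r_def)
  define B where "B = exp (1 / (1 - r))"
  have bound: "norm (gauss_factor n s q) \<le> B" for n s
  proof -
    have "norm (gauss_factor n s q) \<le> (\<Prod>k\<in>{s<..n}. 1 + r ^ k)"
      unfolding gauss_factor_def prod_norm[symmetric]
      by (intro prod_mono) (auto simp: r_def norm_power intro: order.trans[OF norm_triangle_ineq4])
    also have "\<dots> \<le> (\<Prod>k\<in>{s<..n}. exp (r ^ k))"
      using r by (intro prod_mono) (auto simp: add_nonneg_nonneg)
    also have "\<dots> = exp (\<Sum>k\<in>{s<..n}. r ^ k)" by (simp add: exp_sum)
    also have "(\<Sum>k\<in>{s<..n}. r ^ k) \<le> (\<Sum>k. r ^ k)"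
      using r by (intro sum_le_suminf summable_geometric) auto
    also have "(\<Sum>k. r ^ k) = 1 / (1 - r)" using r by (intro suminf_geometric) auto
    finally show ?thesis by (simp add: B_def)
  qed
  have "(\<lambda>n. (\<Prod>i\<le>n. 1 - q ^ Suc i)) \<longlonglongrightarrow> (\<Prod>n. 1 - q ^ Suc n)"
    by (intro convergent_prod_LIMSEQ convergent_euler_product q)
  moreover have "(\<Prod>i\<le>n. 1 - q ^ Suc i) = gauss_factor (Suc n) 0 q" for n
    unfolding gauss_factor_def by (rule prod.reindex_bij_witness[of _ "\<lambda>k. k - 1" Suc]) auto
  ultimately have main: "(\<lambda>n. gauss_factor n 0 q) \<longlonglongrightarrow> (\<Prod>n. 1 - q ^ Suc n)"
    by (simp only:) (rule LIMSEQ_imp_Suc)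
  have "(\<lambda>n. (\<Sum>s\<in>{1..n}. (-1) ^ s * gauss_factor n s q * q ^ (s * n + s * (s + 1) div 2))) \<longlonglongrightarrow> 0"
  proof (rule Lim_null_comparison)
    show "\<forall>\<^sub>F n in sequentially. norm (\<Sum>s\<in>{1..n}. (-1) ^ s * gauss_factor n s q * q ^ (s * n + s * (s + 1) div 2))
        \<le> B * (of_nat n * r ^ n)"
    proof (intro always_eventually allI)
      fix n
      have "norm (\<Sum>s\<in>{1..n}. (-1) ^ s * gauss_factor n s q * q ^ (s * n + s * (s + 1) div 2)) \<le>
          of_nat (card {1..n}) * (B * r ^ n)"
      proof (rule sum_norm_bound)
        fix s assume "s \<in> {1..n}"
        then have "n \<le> s * n + s * (s + 1) div 2" by (cases s) auto
        then have "r ^ (s * n + s * (s + 1) div 2) \<le> r ^ n" using r by (intro power_decreasing) auto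
        then show "norm ((-1) ^ s * gauss_factor n s q * q ^ (s * n + s * (s + 1) div 2)) \<le> B * r ^ n"
          using bound[of n s] r by (simp add: norm_mult norm_power r_def[symmetric] mult_mono B_def)
      qed
      then show "norm (\<Sum>s\<in>{1..n}. (-1) ^ s * gauss_factor n s q * q ^ (s * n + s * (s + 1) div 2))
        \<le> B * (of_nat n * r ^ n)" by (simp add: mult.left_commute)
    qed
    have "(\<lambda>n. of_nat n * r ^ n) \<longlonglongrightarrow> 0" using r by (intro powser_times_n_limit_0) auto
    then show "(\<lambda>n. B * (of_nat n * r ^ n)) \<longlonglongrightarrow> 0" by (rule tendsto_mult_right_zero)
  qed
  from tendsto_add[OF main this]
  have "(\<lambda>n. gauss_factor n 0 q + (\<Sum>s\<in>{1..n}. (-1) ^ s * gauss_factor n s q * q ^ (s * n + s * (s + 1) div 2))) \<longlonglongrightarrow>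
    (\<Prod>n. 1 - q ^ Suc n)" by simp
  moreover have "{..n} = insert 0 {1..n}" for n :: nat by auto
  ultimately show ?thesis by simp
qed

theorem pentagonal_number_theorem:
  fixes q :: complex
  assumes q: "norm q < 1"
  shows "(\<lambda>n. (-1) ^ n * q ^ (n * (3 * n + 1) div 2) * (1 - q ^ (2 * n + 1))) sums (\<Prod>n. 1 - q ^ Suc n)"
proof -
  define T where "T n = 1 + (\<Sum>s\<in>{1..n}. (-1) ^ s * (q ^ (s * (3 * s - 1) div 2) + q ^ (s * (3 * s + 1) div 2)))" for n
  \<comment> \<open>The series pairs n(3n+1)/2 with (n+1)(3n+2)/2, whereas \<open>T\<close> pairs
    s(3s-1)/2 with s(3s+1)/2; the partial sums differ by one unpaired term, which tends to
    0.\<close>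
  have part: "(\<Sum>i<n. (-1) ^ i * q ^ (i * (3 * i + 1) div 2) * (1 - q ^ (2 * i + 1))) =
      T n - (-1) ^ n * q ^ (n * (3 * n + 1) div 2)" for n
  proof (induction n)
    case (Suc n)
    have "Suc n * (3 * Suc n - 1) = n * (3 * n + 1) + (2 * n + 1) * 2" by (simp add: algebra_simps)
    then have "Suc n * (3 * Suc n - 1) div 2 = n * (3 * n + 1) div 2 + (2 * n + 1)"
      by (simp only: div_mult_self1)
    moreover have "{1..Suc n} = insert (Suc n) {1..n}" by auto
    ultimately show ?case using Suc by (simp add: T_def algebra_simps power_add)
  qed (simp add: T_def)
  have "(\<lambda>n. (-1) ^ n * q ^ (n * (3 * n + 1) div 2)) \<longlonglongrightarrow> 0"
  proof (rule Lim_null_comparison)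
    show "(\<lambda>n. norm q ^ n) \<longlonglongrightarrow> 0" using q by (intro LIMSEQ_power_zero) auto
    have "n \<le> n * (3 * n + 1) div 2" for n :: nat
      by (cases n) (auto simp: less_eq_div_iff_mult_less_eq)
    then show "\<forall>\<^sub>F n in sequentially. norm ((-1) ^ n * q ^ (n * (3 * n + 1) div 2)) \<le> norm q ^ n"
      using q by (intro always_eventually allI) (simp add: norm_mult norm_power power_decreasing)
  qed
  moreover have "T \<longlonglongrightarrow> (\<Prod>n. 1 - q ^ Suc n)"
    using pentagonal_finite_limit[OF q] unfolding pentagonal_finite T_def .
  ultimately have "(\<lambda>n. T n - (-1) ^ n * q ^ (n * (3 * n + 1) div 2)) \<longlonglongrightarrow> (\<Prod>n. 1 - q ^ Suc n) - 0"
    by (intro tendsto_diff)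
  then show ?thesis unfolding sums_def part by simp
qed

section \<open>The expansion of the false theta function\<close>

text \<open>At w = 0 the grouped series of \<open>partial_theta_sums\<close> is the pentagonal
  number series.\<close>

lemma theta_moment_0:
  assumes "norm q < 1"
  shows "theta_moment 0 q = (\<Prod>n. 1 - q ^ Suc n)"
proof -
  have "theta_moment 0 q = partial_theta q 0" by (simp add: theta_moment_def partial_theta_def)
  also have "\<dots> = (\<Prod>n. 1 - q ^ Suc n)"
    using partial_theta_sums[OF assms, of 0] pentagonal_number_theorem[OF assms]
    by (intro sums_unique2) simp_all
  finally show ?thesis .
qed

lemma theta_moment_0_nonzero: "norm q < 1 \<Longrightarrow> theta_moment 0 q \<noteq> 0"
  using theta_moment_0 euler_product_nonzero by simp

section \<open>Convergence of the solutions in the whole unit disc\<close>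

lemma theta_fps_0_nth_0: "fps_nth (theta_fps 0) 0 = 1"
proof -
  have "pent_fibre 0 = {0}" by (auto simp: pent_fibre_def pent_def)
  then show ?thesis by (simp add: theta_fps_def theta_sign_def)
qed

lemma eval_theta_fps_0_nonzero: "z \<in> eball 0 1 \<Longrightarrow> eval_fps (theta_fps 0) z \<noteq> 0"
  using theta_moment_0_nonzero[of z] by (simp add: eval_theta_fps)

lemma eval_theta_fps_holomorphic: "eval_fps (theta_fps k) holomorphic_on eball 0 1"
  using theta_fps_conv_radius eball_mono by (intro holomorphic_on_eval_fps) blast

lemma theta_fps_has_expansion: "eval_fps (theta_fps k) has_fps_expansion theta_fps k"
  using theta_fps_conv_radius[of k] by (intro eval_fps_has_fps_expansion) (auto intro: less_le_trans[of _ 1])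

text \<open>The Euler product has no zero in the unit disc, so its reciprocal is holomorphic
  there.\<close>

lemma inverse_theta_fps_conv_radius: "fps_conv_radius (inverse (theta_fps 0)) \<ge> 1"
proof (rule holomorphic_on_imp_fps_conv_radius_ge)
  show "(\<lambda>x. inverse (eval_fps (theta_fps 0) x)) has_fps_expansion inverse (theta_fps 0)"
    by (intro has_fps_expansion_inverse theta_fps_has_expansion) (simp add: theta_fps_0_nth_0)
  show "(\<lambda>x. inverse (eval_fps (theta_fps 0) x)) holomorphic_on eball 0 1"
    by (intro holomorphic_on_inverse eval_theta_fps_holomorphic eval_theta_fps_0_nonzero)
qed

lemma fps_conv_radius_sum_ge:
  assumes "\<And>j. j \<in> A \<Longrightarrow> fps_conv_radius (f j) \<ge> r"
  shows "fps_conv_radius (\<Sum>j\<in>A. f j) \<ge> r"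
  using assms by (induction A rule: infinite_finite_induct) (auto intro: fps_conv_radius_add_ge)

lemma eval_fps_sum:
  fixes f :: "'b \<Rightarrow> 'a :: {banach, real_normed_div_algebra} fps"
  assumes "\<And>j. j \<in> A \<Longrightarrow> fps_conv_radius (f j) > ereal (norm z)"
  shows "eval_fps (\<Sum>j\<in>A. f j) z = (\<Sum>j\<in>A. eval_fps (f j) z)"
  using assms
proof (induction A rule: infinite_finite_induct)
  case (insert x A)
  obtain r where r: "ereal (norm z) < r" "\<And>j. j \<in> A \<Longrightarrow> r \<le> fps_conv_radius (f j)"
  proof (cases "A = {}")
    case False
    define r where "r = Min ((\<lambda>j. fps_conv_radius (f j)) ` A)"
    have "ereal (norm z) < r" using insert False by (auto simp: r_def)
    moreover have "\<And>j. j \<in> A \<Longrightarrow> r \<le> fps_conv_radius (f j)" using insert by (auto simp: r_def)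
    ultimately show ?thesis using that by blast
  qed (use that[of \<infinity>] in auto)
  have "ereal (norm z) < fps_conv_radius (\<Sum>j\<in>A. f j)"
    using r fps_conv_radius_sum_ge by (metis less_le_trans)
  then show ?case using insert by (simp add: eval_fps_add)
qed auto

text \<open>Solving the triangular recursion for \<open>b_fps k\<close> only multiplies by
  \<open>inverse (theta_fps 0)\<close>, so the radius is inherited inductively without an estimate
  of the coefficients.\<close>

lemma b_fps_conv_radius: "fps_conv_radius (b_fps k) \<ge> 1"
proof (induction k rule: less_induct)
  case (less k)
  define R where "R = (\<Sum>j<k. of_nat (k choose j) * (theta_fps (k - j) * b_fps j))"
  have "R + theta_fps 0 * b_fps k = - theta_fps (Suc k)"
    using b_fps_rec[of k] by (simp add: R_def lessThan_Suc_atMost[symmetric])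
  then have "theta_fps 0 * b_fps k = - theta_fps (Suc k) - R" by (simp add: algebra_simps)
  then have "inverse (theta_fps 0) * (theta_fps 0 * b_fps k) = inverse (theta_fps 0) * (- theta_fps (Suc k) - R)"
    by simp
  then have "b_fps k = inverse (theta_fps 0) * (- theta_fps (Suc k) - R)"
    by (simp add: mult.assoc[symmetric] inverse_mult_eq_1 theta_fps_0_nth_0)
  moreover have "fps_conv_radius R \<ge> 1"
    unfolding R_def
    by (intro fps_conv_radius_sum_ge fps_conv_radius_mult_ge theta_fps_conv_radius less.IH) auto
  ultimately show ?case
    using inverse_theta_fps_conv_radius theta_fps_conv_radius[of "Suc k"]
    by (auto intro!: fps_conv_radius_mult_ge fps_conv_radius_diff_ge)
qed

lemma eval_b_fps_rec:
  assumes q: "norm q < 1"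
  shows "(\<Sum>j\<le>k. of_nat (k choose j) * (theta_moment (k - j) q * eval_fps (b_fps j) q)) =
    - theta_moment (Suc k) q"
proof -
  have q1: "ereal (norm q) < 1" using q by simp
  have rad: "ereal (norm q) < fps_conv_radius F" if "fps_conv_radius F \<ge> 1" for F :: "complex fps"
    using less_le_trans[OF q1 that] .
  have "eval_fps (- theta_fps (Suc k)) q =
      (\<Sum>j\<le>k. eval_fps (of_nat (k choose j) * (theta_fps (k - j) * b_fps j)) q)"
    unfolding b_fps_rec[symmetric]
    by (intro eval_fps_sum rad fps_conv_radius_mult_ge theta_fps_conv_radius b_fps_conv_radius) simp
  also have "\<dots> = (\<Sum>j\<le>k. of_nat (k choose j) * (theta_moment (k - j) q * eval_fps (b_fps j) q))"
  proof (rule sum.cong[OF refl])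
    fix j
    have "eval_fps (of_nat (k choose j) * (theta_fps (k - j) * b_fps j)) q =
        eval_fps (of_nat (k choose j)) q * (eval_fps (theta_fps (k - j)) q * eval_fps (b_fps j) q)"
      by (subst eval_fps_mult eval_fps_mult rad fps_conv_radius_mult_ge theta_fps_conv_radius b_fps_conv_radius;
        (intro rad fps_conv_radius_mult_ge theta_fps_conv_radius b_fps_conv_radius)?; simp?)+
    then show "eval_fps (of_nat (k choose j) * (theta_fps (k - j) * b_fps j)) q =
        of_nat (k choose j) * (theta_moment (k - j) q * eval_fps (b_fps j) q)"
      using q by (simp add: eval_theta_fps flip: fps_of_nat)
  qed
  finally show ?thesis
    using q by (simp add: eval_fps_minus eval_theta_fps rad theta_fps_conv_radius)
qed

text \<open>On the disc, which is convex, the nonvanishing Euler product has a holomorphic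
  logarithm. Its normalized Taylor series and \<open>- log_fps\<close> have equal derivatives by
  \<open>log_fps_deriv\<close> and constant term 0, so they coincide, and the radius
  follows.\<close>

lemma exp_log_fps:
  assumes q: "norm q < 1"
  shows "fps_conv_radius log_fps \<ge> 1" "theta_moment 0 q = exp (- eval_fps log_fps q)"
proof -
  define H where "H = eval_fps (theta_fps 0)"
  have "convex (eball (0::complex) 1)" "open (eball (0::complex) 1)" "0 \<in> eball (0::complex) 1"
    by (simp_all add: one_ereal_def)
  then obtain g where g: "g holomorphic_on eball 0 1" "\<And>z. z \<in> eball 0 1 \<Longrightarrow> exp (g z) = H z"
    using holomorphic_logarithm_exists[of "eball 0 1" H 0] eval_theta_fps_holomorphic[of 0]
      eval_theta_fps_0_nonzero unfolding H_def by metis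
  \<comment> \<open>Only \<open>exp (g 0) = 1\<close> is known; subtracting \<open>g 0\<close> makes
    the constant term 0, as composition with \<open>fps_exp 1\<close> requires.\<close>
  define G where "G = fps_expansion (\<lambda>z. g z - g 0) 0"
  have hol: "(\<lambda>z. g z - g 0) holomorphic_on eball 0 1" by (intro holomorphic_intros g)
  have G: "(\<lambda>z. g z - g 0) has_fps_expansion G"
    unfolding G_def using hol by (intro analytic_at_imp_has_fps_expansion_0)
      (auto simp: analytic_at one_ereal_def intro!: exI[of _ "ball 0 1"])
  have G0: "fps_nth G 0 = 0" using has_fps_expansion_imp_0_eq_fps_nth_0[OF G] by simp
  have "exp (g 0) = 1"
    using g(2)[of 0] by (simp add: H_def eval_fps_at_0 theta_fps_0_nth_0 one_ereal_def)
  then have expg: "exp (g z - g 0) = H z" if "z \<in> eball 0 1" for z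
    using g(2)[OF that] by (simp add: exp_diff)
  have "(exp \<circ> (\<lambda>z. g z - g 0)) has_fps_expansion (fps_exp 1 oo G)"
    by (intro has_fps_expansion_compose has_fps_expansion_exp1 G G0)
  moreover have "\<forall>\<^sub>F z in nhds 0. (exp \<circ> (\<lambda>z. g z - g 0)) z = H z"
    using eventually_nhds_in_open[of "eball (0::complex) 1" 0]
    by (auto simp: one_ereal_def expg elim!: eventually_mono)
  ultimately have "H has_fps_expansion (fps_exp 1 oo G)"
    using has_fps_expansion_cong by blast
  then have H_eq: "theta_fps 0 = fps_exp 1 oo G"
    using theta_fps_has_expansion[of 0] fps_expansion_unique_complex unfolding H_def by blast
  have "fps_deriv (theta_fps 0) = theta_fps 0 * fps_deriv G"
    unfolding H_eq fps_compose_deriv[OF G0] by simp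
  then have "theta_fps 0 * fps_deriv (log_fps + G) = 0"
    using log_fps_deriv by (simp add: distrib_left)
  moreover have "theta_fps 0 \<noteq> 0" using theta_fps_0_nth_0 by auto
  ultimately have "fps_deriv (log_fps + G) = 0" by (simp only: mult_eq_0_iff simp_thms)
  moreover have "fps_nth (log_fps + G) 0 = 0" by (simp add: log_fps_def G0)
  ultimately have "log_fps + G = 0" by (metis fps_deriv_eq_0_iff fps_const_0_eq_0)
  then have log_eq: "log_fps = - G" by (simp add: eq_neg_iff_add_eq_0)
  have radG: "fps_conv_radius G \<ge> 1" by (rule holomorphic_on_imp_fps_conv_radius_ge[OF G hol])
  then show "fps_conv_radius log_fps \<ge> 1" by (simp add: log_eq)
  have "eval_fps G q = g q - g 0"
    by (rule has_fps_expansion_imp_eval_fps_eq[OF G q]) (use hol in \<open>simp add: one_ereal_def\<close>)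
  moreover have "ereal (norm q) < fps_conv_radius G"
    using q by (intro less_le_trans[OF _ radG]) simp
  ultimately have "- eval_fps log_fps q = g q - g 0" by (simp add: log_eq eval_fps_minus)
  then show "theta_moment 0 q = exp (- eval_fps log_fps q)"
    using expg[of q] q by (simp add: H_def eval_theta_fps)
qed

section \<open>Taylor coefficients in w = 2 pi i z\<close>

lemma sin_half_exp: "- 2 * \<i> * sin (w / (2 * \<i>)) = exp (- w / 2) * (1 - exp w)"
proof -
  \<comment> \<open>With w = 2 pi i z the argument of the sine is pi z. Its prefactor contains the
    factor \<open>1 - exp w\<close> of \<open>false_theta\<close>; the remaining
    \<open>exp (- w / 2)\<close> is the origin of the -1/2 in h_1.\<close>
  have "- 2 * \<i> * sin x = exp (- (\<i> * x)) - exp (\<i> * x)" for x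
    unfolding sin_exp_eq by (simp add: field_simps)
  then have "- 2 * \<i> * sin (w / (2 * \<i>)) = exp (- (w / 2)) - exp (w / 2)" by simp
  moreover have "exp (- (w / 2)) * exp w = exp (w / 2)" by (simp flip: exp_add)
  ultimately show ?thesis by (simp add: right_diff_distrib)
qed

lemma qpow_inverse: "qpow \<tau> (-1/24) * eta \<tau> = (\<Prod>n. 1 - qpow \<tau> 1 ^ Suc n)"
proof -
  have "qpow \<tau> (-1/24) * qpow \<tau> (1/24) = 1"
    by (simp add: qpow_def of_rat_minus of_rat_divide flip: exp_add)
  then show ?thesis by (simp add: eta_def flip: mult.assoc)
qed

lemma norm_qpow_less_1: "Im \<tau> > 0 \<Longrightarrow> norm (qpow \<tau> 1) < 1"
  by (simp add: qpow_def)

lemma eventually_nhds_0_scale: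
  fixes c :: complex
  assumes "c \<noteq> 0"
  shows "eventually P (nhds 0) \<longleftrightarrow> eventually (\<lambda>z. P (c * z)) (nhds 0)"
proof
  have lim: "((\<lambda>z. a * z) \<longlongrightarrow> 0) (nhds 0)" for a :: complex
    by (rule tendsto_eq_intros refl filterlim_ident | simp)+
  show "eventually (\<lambda>z. P (c * z)) (nhds 0)" if "eventually P (nhds 0)"
    using eventually_compose_filterlim[OF that lim] .
  show "eventually P (nhds 0)" if "eventually (\<lambda>z. P (c * z)) (nhds 0)"
    using eventually_compose_filterlim[OF that lim[of "inverse c"]] assms
    by (simp flip: mult.assoc)
qed

text \<open>Substitute w = 2 pi i z and divide by \<open>1 - exp w\<close>, whose zeros are the
  multiples of 2 pi i, so that only 0 lies in the unit ball. At w = 0 the divided equation holds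
  anyway, both sides being \<open>theta_moment 0 q\<close>.\<close>

lemma false_theta_expansion_iff:
  assumes "Im \<tau> > 0"
  defines "q \<equiv> qpow \<tau> 1"
  shows "false_theta_expansion \<tau> c \<longleftrightarrow> (\<forall>\<^sub>F w in nhds 0.
      summable (\<lambda>k. c (Suc k) * w ^ Suc k / fact (Suc k)) \<and>
      partial_theta q w = theta_moment 0 q * exp (- (w / 2 + (\<Sum>k. c (Suc k) * w ^ Suc k / fact (Suc k)))))"
proof -
  have q: "norm q < 1" using assms by (simp add: q_def norm_qpow_less_1)
  define S where "S w = (\<Sum>k. c (Suc k) * w ^ Suc k / fact (Suc k))" for w
  let ?sm = "\<lambda>w. summable (\<lambda>k. c (Suc k) * w ^ Suc k / fact (Suc k))"
  have S0: "S 0 = 0" by (simp add: S_def)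
  have P: "qpow \<tau> (-1/24) * eta \<tau> = theta_moment 0 q"
    unfolding qpow_inverse q_def by (rule theta_moment_0[OF q[unfolded q_def], symmetric])
  have pt0: "partial_theta q 0 = theta_moment 0 q" by (simp add: theta_moment_def partial_theta_def)
  have "\<forall>\<^sub>F w in nhds 0. w \<in> ball (0::complex) 1"
    by (intro eventually_nhds_in_open) auto
  then have ne: "\<forall>\<^sub>F w in nhds (0::complex). w = 0 \<or> exp w \<noteq> 1"
  proof eventually_elim
    case (elim w)
    show ?case
    proof (rule ccontr)
      assume "\<not> (w = 0 \<or> exp w \<noteq> 1)"
      then obtain n :: int where n: "Re w = 0" "Im w = of_int (2 * n) * pi" "w \<noteq> 0"
        by (auto simp: exp_eq_1)
      then have "n \<noteq> 0" by (auto simp: complex_eq_iff)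
      then have "1 \<le> \<bar>of_int n :: real\<bar>" by linarith
      then have "1 * 3 \<le> \<bar>of_int n\<bar> * pi" using pi_gt3 by (intro mult_mono) auto
      then have "1 \<le> \<bar>Im w\<bar>" using n by (simp add: abs_mult)
      then show False using elim abs_Im_le_cmod[of w] by simp
    qed
  qed
  have "false_theta_expansion \<tau> c \<longleftrightarrow> (\<forall>\<^sub>F w in nhds 0. ?sm w \<and>
      false_theta (exp w) q = - 2 * \<i> * sin (w / (2 * \<i>)) * theta_moment 0 q * exp (- S w))"
  proof -
    have P': "x * qpow \<tau> (-1/24) * eta \<tau> = x * theta_moment 0 q" for x
      by (simp only: P[symmetric] mult.assoc)
    have "2 * of_real pi * \<i> * z / (2 * \<i>) = of_real pi * z" for z
      by (subst nonzero_divide_eq_eq) (simp_all add: mult_ac)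
    then show ?thesis
      unfolding false_theta_expansion_def q_def[symmetric] S_def P'
      by (subst (2) eventually_nhds_0_scale[of "2 * of_real pi * \<i>"]) (simp, simp only:)
  qed
  also have "\<dots> \<longleftrightarrow> (\<forall>\<^sub>F w in nhds 0. ?sm w \<and> partial_theta q w = theta_moment 0 q * exp (- (w / 2 + S w)))"
  proof (intro eventually_cong[OF ne])
    fix w :: complex assume w: "w = 0 \<or> exp w \<noteq> 1"
    have eq: "- 2 * \<i> * sin (w / (2 * \<i>)) * theta_moment 0 q * exp (- S w) =
        (1 - exp w) * (theta_moment 0 q * exp (- (w / 2 + S w)))"
    proof -
      have "exp (- (w / 2 + S w)) = exp (- w / 2) * exp (- S w)" by (simp flip: exp_add)
      then show ?thesis unfolding sin_half_exp by (simp only: mult_ac)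
    qed
    show "(?sm w \<and> false_theta (exp w) q = - 2 * \<i> * sin (w / (2 * \<i>)) * theta_moment 0 q * exp (- S w)) \<longleftrightarrow>
        (?sm w \<and> partial_theta q w = theta_moment 0 q * exp (- (w / 2 + S w)))"
      unfolding false_theta_exp[OF q] eq using w by (auto simp: S0 pt0)
  qed
  finally show ?thesis unfolding S_def .
qed

text \<open>Near w = 0 the quotient \<open>partial_theta q w / M\<close> is close to 1, so the
  principal logarithm is analytic there; the coefficients are \<open>fact k\<close> times the Taylor
  coefficients of minus this logarithm minus w/2.\<close>

lemma false_theta_expansion_exists:
  assumes "Im \<tau> > 0"
  shows "\<exists>c. false_theta_expansion \<tau> c"
proof -
  define q where "q = qpow \<tau> 1"
  have q: "norm q < 1" using assms by (simp add: q_def norm_qpow_less_1)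
  define M where "M = theta_moment 0 q"
  have M: "M \<noteq> 0" using theta_moment_0_nonzero[OF q] by (simp add: M_def)
  have pt0: "partial_theta q 0 = M" by (simp add: theta_moment_def partial_theta_def M_def)
  have an: "partial_theta q analytic_on {0}"
    using partial_theta_has_fps_expansion[OF q] by (rule has_fps_expansion_imp_analytic_0)
  define g where "g w = - Ln (partial_theta q w / M) - w / 2" for w
  have "g analytic_on {0}"
    unfolding g_def using M by (intro analytic_intros an) (auto simp: pt0)
  then have G: "g has_fps_expansion fps_expansion g 0" by (rule analytic_at_imp_has_fps_expansion_0)
  define G where "G = fps_expansion g 0"
  have G0: "fps_nth G 0 = 0"
    using has_fps_expansion_imp_0_eq_fps_nth_0[OF G] M by (simp add: G_def g_def pt0)
  have "fps_conv_radius G > 0" and ev1: "\<forall>\<^sub>F w in nhds 0. eval_fps G w = g w"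
    using G by (simp_all add: has_fps_expansion_def G_def)
  then have ev2: "\<forall>\<^sub>F w in nhds 0. w \<in> eball 0 (fps_conv_radius G)"
    by (intro eventually_nhds_in_open) (auto simp: zero_ereal_def)
  have ev3: "\<forall>\<^sub>F w in nhds 0. partial_theta q w \<noteq> 0"
  proof -
    have "isCont (partial_theta q) 0" using an by (rule analytic_at_imp_isCont)
    then show ?thesis
      using M pt0 unfolding isCont_def tendsto_at_iff_tendsto_nhds
      by (intro tendsto_imp_eventually_ne[of _ M]) auto
  qed
  have "\<forall>\<^sub>F w in nhds 0.
      summable (\<lambda>k. (fps_nth G (Suc k) * fact (Suc k)) * w ^ Suc k / fact (Suc k)) \<and>
      partial_theta q w = M * exp (- (w / 2 + (\<Sum>k. (fps_nth G (Suc k) * fact (Suc k)) * w ^ Suc k / fact (Suc k))))"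
    using ev1 ev2 ev3
  proof eventually_elim
    case (elim w)
    then have "(\<lambda>k. fps_nth G k * w ^ k) sums g w"
      using sums_eval_fps[of w G] by simp
    then have "(\<lambda>k. fps_nth G (Suc k) * w ^ Suc k) sums g w"
      by (subst sums_Suc_iff) (simp add: G0)
    then have "(\<lambda>k. (fps_nth G (Suc k) * fact (Suc k)) * w ^ Suc k / fact (Suc k)) sums g w"
      by (simp del: fact_Suc)
    then show ?case using M elim by (auto simp: sums_iff g_def)
  qed
  then have "false_theta_expansion \<tau> (\<lambda>k. fps_nth G k * fact k)"
    unfolding false_theta_expansion_iff[OF assms] M_def q_def .
  then show ?thesis by blast
qed

text \<open>Differentiating the exponential form gives, for the coefficients of any expansion, the
  triangular system of \<open>eval_b_fps_rec\<close>. Its diagonal entry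
  \<open>theta_moment 0 q\<close> is nonzero, so the solutions agree.\<close>

lemma false_theta_expansion_coeff:
  assumes "Im \<tau> > 0" and c: "false_theta_expansion \<tau> c"
  shows "c (Suc k) = eval_fps (b_fps k) (qpow \<tau> 1) - (if k = 0 then 1 / 2 else 0)"
proof -
  define q where "q = qpow \<tau> 1"
  have q: "norm q < 1" using assms by (simp add: q_def norm_qpow_less_1)
  define S where "S w = (\<Sum>k. c (Suc k) * w ^ Suc k / fact (Suc k))" for w
  define D where "D = Abs_fps (\<lambda>k. if k = 0 then 0 else c k / fact k)"
  define D' where "D' = fps_const (1 / 2) * fps_X + D"
  define F where "F = Abs_fps (\<lambda>k. theta_moment k q / fact k)"
  \<comment> \<open>The summand w/2 of the exponent affects only its linear coefficient, which is
    the case \<open>j = 0\<close>.\<close>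
  define g where "g j = c (Suc j) + (if j = 0 then 1 / 2 else 0)" for j
  have ev: "\<forall>\<^sub>F w in nhds 0. summable (\<lambda>k. c (Suc k) * w ^ Suc k / fact (Suc k)) \<and>
      partial_theta q w = theta_moment 0 q * exp (- (w / 2 + S w))"
    using c unfolding false_theta_expansion_iff[OF assms(1)] S_def q_def .
  have "S has_fps_expansion D"
  proof (rule has_fps_expansionI, use ev in eventually_elim)
    case (elim w)
    then have "(\<lambda>k. fps_nth D (Suc k) * w ^ Suc k) sums S w"
      by (simp add: D_def S_def summable_sums_iff mult.commute)
    then show ?case by (subst (asm) sums_Suc_iff) (simp add: D_def)
  qed
  then have D': "(\<lambda>w. - (1 / 2 * w + S w)) has_fps_expansion - D'"
    unfolding D'_def by (intro fps_expansion_intros)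
  have D'0: "fps_nth (- D') 0 = 0" by (simp add: D'_def D_def)
  have "(exp \<circ> (\<lambda>w. - (1 / 2 * w + S w))) has_fps_expansion (fps_exp 1 oo - D')"
    by (intro has_fps_expansion_compose has_fps_expansion_exp1 D' D'0)
  then have "(\<lambda>w. theta_moment 0 q * (exp \<circ> (\<lambda>w. - (1 / 2 * w + S w))) w) has_fps_expansion
      fps_const (theta_moment 0 q) * (fps_exp 1 oo - D')"
    by (rule has_fps_expansion_cmult_left)
  moreover have "\<forall>\<^sub>F w in nhds 0. theta_moment 0 q * (exp \<circ> (\<lambda>w. - (1 / 2 * w + S w))) w = partial_theta q w"
    using ev by eventually_elim simp
  ultimately have "partial_theta q has_fps_expansion fps_const (theta_moment 0 q) * (fps_exp 1 oo - D')"
    by (rule iffD1[OF has_fps_expansion_cong[OF _ refl], rotated])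
  then have F_eq: "F = fps_const (theta_moment 0 q) * (fps_exp 1 oo - D')"
    using partial_theta_has_fps_expansion[OF q] fps_expansion_unique_complex unfolding F_def by blast
  have deriv: "fps_deriv F = - (fps_deriv D' * F)"
    unfolding F_eq by (simp add: fps_compose_deriv[OF D'0] mult_ac)
  have rec: "(\<Sum>j\<le>n. of_nat (n choose j) * (theta_moment (n - j) q * g j)) = - theta_moment (Suc n) q" for n
  proof -
    have nthF: "fps_nth (fps_deriv F) n = theta_moment (Suc n) q / fact n"
      by (simp add: F_def field_simps del: of_nat_Suc)
    have nthD: "fps_nth (fps_deriv D') j = g j / fact j" for j
      by (cases j) (simp_all add: D'_def D_def g_def field_simps del: of_nat_Suc)
    have "theta_moment (Suc n) q / fact n = - (\<Sum>j\<le>n. g j / fact j * (theta_moment (n - j) q / fact (n - j)))"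
      using arg_cong[OF deriv, of "\<lambda>X. fps_nth X n"]
      unfolding nthF fps_neg_nth fps_mult_nth nthD by (simp add: F_def atLeast0AtMost)
    moreover have "a = fact n * b" if "a / fact n = b" for a b :: complex
      using that by auto
    ultimately have "theta_moment (Suc n) q =
        fact n * - (\<Sum>j\<le>n. g j / fact j * (theta_moment (n - j) q / fact (n - j)))" by blast
    also have "\<dots> = - (\<Sum>j\<le>n. fact n * (g j / fact j * (theta_moment (n - j) q / fact (n - j))))"
      by (simp only: sum_distrib_left mult_minus_right)
    also have "(\<Sum>j\<le>n. fact n * (g j / fact j * (theta_moment (n - j) q / fact (n - j)))) =
        (\<Sum>j\<le>n. of_nat (n choose j) * (theta_moment (n - j) q * g j))"
      by (intro sum.cong refl) (simp add: binomial_fact field_simps)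
    finally show ?thesis by simp
  qed
  have "g n = eval_fps (b_fps n) q" for n
  proof (induction n rule: less_induct)
    case (less n)
    have "(\<Sum>j<n. of_nat (n choose j) * (theta_moment (n - j) q * g j)) =
        (\<Sum>j<n. of_nat (n choose j) * (theta_moment (n - j) q * eval_fps (b_fps j) q))"
      using less by simp
    moreover have "(\<Sum>j\<le>n. of_nat (n choose j) * (theta_moment (n - j) q * g j)) =
        (\<Sum>j\<le>n. of_nat (n choose j) * (theta_moment (n - j) q * eval_fps (b_fps j) q))"
      unfolding rec eval_b_fps_rec[OF q] ..
    ultimately have "theta_moment 0 q * g n = theta_moment 0 q * eval_fps (b_fps n) q"
      by (simp add: lessThan_Suc_atMost[symmetric])
    then show ?case using theta_moment_0_nonzero[OF q] by simp
  qed
  then have "g k = eval_fps (b_fps k) q" .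
  then show ?thesis by (auto simp: g_def q_def eq_diff_eq)
qed

text \<open>An expansion exists and every expansion has this coefficient, so the definite
  description is well defined.\<close>

lemma false_eisenstein_Suc:
  assumes "Im \<tau> > 0"
  shows "false_eisenstein (Suc k) \<tau> = eval_fps (b_fps k) (qpow \<tau> 1) - (if k = 0 then 1 / 2 else 0)"
  unfolding false_eisenstein_def
proof (rule the_equality)
  show "\<exists>c. false_theta_expansion \<tau> c \<and>
      c (Suc k) = eval_fps (b_fps k) (qpow \<tau> 1) - (if k = 0 then 1 / 2 else 0)"
    using false_theta_expansion_exists[OF assms] false_theta_expansion_coeff[OF assms] by blast
qed (use false_theta_expansion_coeff[OF assms] in blast)

section \<open>Translation into the series of the theorem\<close>

lemma fps_sums_Suc:
  fixes F :: "complex fps"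
  assumes "fps_conv_radius F \<ge> 1" "fps_nth F 0 = 0" "norm q < 1"
  shows "(\<lambda>n. fps_nth F (Suc n) * q ^ Suc n) sums eval_fps F q"
proof -
  have "ereal (norm q) < fps_conv_radius F"
    using assms by (intro less_le_trans[OF _ assms(1)]) simp
  then have "(\<lambda>n. fps_nth F n * q ^ n) sums eval_fps F q" by (intro sums_eval_fps)
  then show ?thesis by (subst sums_Suc_iff) (simp add: assms(2))
qed

text \<open>Lets the sums over \<open>m\<close> start at 1; in \<open>b_fps 0\<close> the power
  \<open>0 ^ 0 = 1\<close> alone would not remove the term at 0.\<close>

lemma b_coeff_0_right [simp]: "b_coeff n 0 = 0"
  by (simp add: b_coeff_def)

lemma sum_atMost_eq_atLeast1:
  fixes f :: "nat \<Rightarrow> 'a::comm_monoid_add"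
  shows "f 0 = 0 \<Longrightarrow> (\<Sum>m\<le>n. f m) = (\<Sum>m=1..n. f m)"
  by (intro sum.mono_neutral_right) (auto simp: Suc_le_eq)

lemma b_fps_nth: "fps_nth (b_fps k) n = (\<Sum>m=1..2 * n. of_real (b_coeff n m) * of_nat m ^ k)"
  by (simp add: b_fps_def sum_atMost_eq_atLeast1)

lemma log_fps_nth: "fps_nth log_fps n = (\<Sum>m=1..2 * n. of_real (b_coeff n m) / of_nat m)"
  by (simp add: log_fps_def sum_atMost_eq_atLeast1)

theorem theorem1p6:
  shows "(\<forall>n\<ge>1. \<forall>m\<ge>1. b_coeff n m \<in> \<int> \<and>
            (int m < \<lfloor>(sqrt (24 * real n + 1) - 1) / 2\<rfloor> \<longrightarrow> b_coeff n m = 0)) \<and>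
         (\<forall>\<tau>::complex. Im \<tau> > 0 \<longrightarrow>
            (\<forall>k\<ge>1.
               summable (\<lambda>n. (\<Sum>m=1..2 * Suc n. of_real (b_coeff (Suc n) m) * of_nat m ^ (k - 1)) * qpow \<tau> 1 ^ Suc n) \<and>
               false_eisenstein k \<tau> =
                 - (if k = 1 then 1 else 0) / 2 +
                 (\<Sum>n. (\<Sum>m=1..2 * Suc n. of_real (b_coeff (Suc n) m) * of_nat m ^ (k - 1)) * qpow \<tau> 1 ^ Suc n)) \<and>
            summable (\<lambda>n. (\<Sum>m=1..2 * Suc n. of_real (b_coeff (Suc n) m) / of_nat m) * qpow \<tau> 1 ^ Suc n) \<and>
            eta \<tau> = qpow \<tau> (1/24) *
              exp (- (\<Sum>n. (\<Sum>m=1..2 * Suc n. of_real (b_coeff (Suc n) m) / of_nat m) * qpow \<tau> 1 ^ Suc n)))"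
proof (intro conjI allI impI)
  fix n m
  show "b_coeff n m \<in> \<int>" by (rule b_coeff_Ints)
  show "b_coeff n m = 0" if "int m < \<lfloor>(sqrt (24 * real n + 1) - 1) / 2\<rfloor>"
    using that by (rule b_coeff_eq_0)
next
  fix \<tau> :: complex and k :: nat assume \<tau>: "Im \<tau> > 0" and k: "k \<ge> 1"
  \<comment> \<open>The constant coefficient is an empty sum over \<open>m\<close>, so the series
    may start at the exponent 1.\<close>
  have "(\<lambda>n. fps_nth (b_fps (k - 1)) (Suc n) * qpow \<tau> 1 ^ Suc n) sums eval_fps (b_fps (k - 1)) (qpow \<tau> 1)"
    by (intro fps_sums_Suc b_fps_conv_radius norm_qpow_less_1 \<tau>) (simp add: b_fps_nth)
  then have sums: "(\<lambda>n. (\<Sum>m=1..2 * Suc n. of_real (b_coeff (Suc n) m) * of_nat m ^ (k - 1)) * qpow \<tau> 1 ^ Suc n)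
      sums eval_fps (b_fps (k - 1)) (qpow \<tau> 1)"
    unfolding b_fps_nth .
  then show "summable (\<lambda>n. (\<Sum>m=1..2 * Suc n. of_real (b_coeff (Suc n) m) * of_nat m ^ (k - 1)) * qpow \<tau> 1 ^ Suc n)"
    by (rule sums_summable)
  have "false_eisenstein k \<tau> = - (if k = 1 then 1 else 0) / 2 + eval_fps (b_fps (k - 1)) (qpow \<tau> 1)"
    using false_eisenstein_Suc[OF \<tau>, of "k - 1"] k by auto
  then show "false_eisenstein k \<tau> = - (if k = 1 then 1 else 0) / 2 +
      (\<Sum>n. (\<Sum>m=1..2 * Suc n. of_real (b_coeff (Suc n) m) * of_nat m ^ (k - 1)) * qpow \<tau> 1 ^ Suc n)"
    unfolding sums_unique[OF sums] .
next
  fix \<tau> :: complex assume \<tau>: "Im \<tau> > 0"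
  have q: "norm (qpow \<tau> 1) < 1" by (rule norm_qpow_less_1[OF \<tau>])
  have "(\<lambda>n. fps_nth log_fps (Suc n) * qpow \<tau> 1 ^ Suc n) sums eval_fps log_fps (qpow \<tau> 1)"
    by (rule fps_sums_Suc[OF exp_log_fps(1)[OF q] _ q]) (simp add: log_fps_nth)
  then have sums: "(\<lambda>n. (\<Sum>m=1..2 * Suc n. of_real (b_coeff (Suc n) m) / of_nat m) * qpow \<tau> 1 ^ Suc n)
      sums eval_fps log_fps (qpow \<tau> 1)"
    unfolding log_fps_nth .
  then show "summable (\<lambda>n. (\<Sum>m=1..2 * Suc n. of_real (b_coeff (Suc n) m) / of_nat m) * qpow \<tau> 1 ^ Suc n)"
    by (rule sums_summable)
  have "eta \<tau> = qpow \<tau> (1/24) * exp (- eval_fps log_fps (qpow \<tau> 1))"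
    unfolding eta_def theta_moment_0[OF q, symmetric] exp_log_fps(2)[OF q] ..
  then show "eta \<tau> = qpow \<tau> (1/24) *
      exp (- (\<Sum>n. (\<Sum>m=1..2 * Suc n. of_real (b_coeff (Suc n) m) / of_nat m) * qpow \<tau> 1 ^ Suc n))"
    unfolding sums_unique[OF sums] .
qed

end
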